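(* Let $w_1,\dots,w_n$ ($n=d+1$) be positive integers with $\gcd(w_1,\dots,w_n)=1$ and $w_i\mid W:=\sum_jw_j$ for all $i$; let $v_1,\dots,v_n$ generate $M\cong\mathbb Z^d$ with $\sum_iw_iv_i=0$, $\Delta=\mathrm{conv}\{v_1,\dots,v_n\}$ (a reflexive simplex), and $f(t)=1-\sum_{i=1}^na_it^{v_i}$. For any homogeneous $P\in\mathbb Q[x_1,\dots,x_n]$ of degree $d$, the toric residue $$R_P(a)=(-1)^d\mathrm{Res}_f\big(t_0^dP(a_1t^{v_1},\dots,a_nt^{v_n})\big)$$ depends only on $y=a_1^{w_1}\cdots a_n^{w_n}$ and equals $$R_P(y)=\frac{\nu\,P(w_1,\dots,w_n)}{1-\mu y},\qquad \nu=\frac1{w_1\cdots w_n},\quad \mu=\frac{W^{W}}{\prod_{i=1}^nw_i^{w_i}}.$$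
   Context: For a reflexive $d$-dimensional lattice polytope $\Delta\subset M_{\mathbb R}$, $S_\Delta=\bigoplus_kS^k_\Delta\subset\mathbb C[t_0,t^{\pm1}]$ with $S^k_\Delta$ spanned by $t_0^kt^m$, $m\in k\Delta\cap M$. For a Laurent polynomial $f$ supported in $\Delta$ put $f_i=t_i\partial f/\partial t_i$, $F_0=t_0f$, $F_i=t_0f_i$; for $\Delta$-regular $f$ (i.e. $F_0,\dots,F_d$ regular in $S_\Delta$) let $H'_f=t_0^d\det M_f$, $M_f$ the $(d+1)\times(d+1)$ matrix with first row and first column $(f,f_1,\dots,f_d)$ and $(i,j)$-entry $t_i\partial f_j/\partial t_i$ for $1\le i,j\le d$. The toric residue $\mathrm{Res}_f:S^d_\Delta\to\mathbb C$ is the linear map vanishing on $\sum_iF_iS^{d-1}_\Delta$ with $\mathrm{Res}_f(H'_f)=\mathrm{Vol}(\Delta)$ ($d!$ times Euclidean volume); it is a rational function of the coefficients of $f$, and the identity is one of rational functions of $a$. *)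

theory Defs
  imports "HOL-Analysis.Analysis" "HOL-Library.Poly_Mapping"
begin

text \<open>Elements of the Laurent ring C[t_0, t^{+-1}] (t = (t_1,..,t_d), M = Z^d = int^('d::finite)):
  finitely supported coefficient functions on exponents (k, m), k = exponent of t_0.\<close>
type_synonym 'd LP = "(nat \<times> (int^'d)) \<Rightarrow>\<^sub>0 complex"

definition mon :: "nat \<Rightarrow> int^('d::finite) \<Rightarrow> ('d::finite) LP" where
  "mon k m = Poly_Mapping.single (k, m) 1"

definition cst :: "complex \<Rightarrow> ('d::finite) LP" where
  "cst c = Poly_Mapping.single (0, 0) c"

definition rvec :: "int^('d::finite) \<Rightarrow> real^'d" where
  "rvec m = (\<chi> j. real_of_int (m $ j))"

definition Delta :: "('n \<Rightarrow> int^('d::finite)) \<Rightarrow> (real^'d) set" where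
  "Delta v = convex hull (range (\<lambda>i. rvec (v i)))"

definition VolDelta :: "('n \<Rightarrow> int^('d::finite)) \<Rightarrow> real" where
  "VolDelta v = fact CARD('d) * measure lebesgue (Delta v)"

definition in_S :: "('n \<Rightarrow> int^('d::finite)) \<Rightarrow> ('d::finite) LP \<Rightarrow> bool" where
  "in_S v g \<longleftrightarrow> (\<forall>(k, m) \<in> Poly_Mapping.keys g. rvec m \<in> (\<lambda>x. real k *\<^sub>R x) ` Delta v)"

definition in_Sk :: "('n \<Rightarrow> int^('d::finite)) \<Rightarrow> nat \<Rightarrow> ('d::finite) LP \<Rightarrow> bool" where
  "in_Sk v k g \<longleftrightarrow> in_S v g \<and> (\<forall>(j, m) \<in> Poly_Mapping.keys g. j = k)"

text \<open>theta_i = t_i d/dt_i\<close>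
definition theta :: "'d \<Rightarrow> ('d::finite) LP \<Rightarrow> ('d::finite) LP" where
  "theta i g = (\<Sum>km\<in>Poly_Mapping.keys g. Poly_Mapping.single km (of_int (snd km $ i) * Poly_Mapping.lookup g km))"

definition fpoly :: "('n::finite \<Rightarrow> int^('d::finite)) \<Rightarrow> ('n \<Rightarrow> complex) \<Rightarrow> ('d::finite) LP" where
  "fpoly v a = mon 0 0 - (\<Sum>i\<in>UNIV. Poly_Mapping.single (0, v i) (a i))"

definition F0 :: "('n::finite \<Rightarrow> int^('d::finite)) \<Rightarrow> ('n \<Rightarrow> complex) \<Rightarrow> ('d::finite) LP" where
  "F0 v a = mon 1 0 * fpoly v a"

definition Fi :: "('n::finite \<Rightarrow> int^('d::finite)) \<Rightarrow> ('n \<Rightarrow> complex) \<Rightarrow> 'd \<Rightarrow> ('d::finite) LP" where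
  "Fi v a i = mon 1 0 * theta i (fpoly v a)"

definition ideal_gen :: "('n \<Rightarrow> int^('d::finite)) \<Rightarrow> ('d::finite) LP list \<Rightarrow> ('d::finite) LP \<Rightarrow> bool" where
  "ideal_gen v Fs g \<longleftrightarrow>
     (\<exists>h. (\<forall>j<length Fs. in_S v (h j)) \<and> g = (\<Sum>j<length Fs. Fs ! j * h j))"

definition regular_seq :: "('n \<Rightarrow> int^('d::finite)) \<Rightarrow> ('d::finite) LP list \<Rightarrow> bool" where
  "regular_seq v Fs \<longleftrightarrow>
     (\<forall>j<length Fs. \<forall>g. in_S v g \<and> ideal_gen v (take j Fs) (Fs ! j * g)
                       \<longrightarrow> ideal_gen v (take j Fs) g)
     \<and> \<not> ideal_gen v Fs (mon 0 0)"

definition Delta_regular :: "('n::finite \<Rightarrow> int^('d::finite)) \<Rightarrow> ('n \<Rightarrow> complex) \<Rightarrow> bool" where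
  "Delta_regular v a \<longleftrightarrow>
     (\<exists>xs. distinct xs \<and> set xs = (UNIV :: 'd set) \<and>
           regular_seq v (F0 v a # map (Fi v a) xs))"

text \<open>the matrix M_f, rows/columns indexed by None (= 0), Some i (= i, 1 <= i <= d)\<close>
definition Mf :: "('n::finite \<Rightarrow> int^('d::finite)) \<Rightarrow> ('n \<Rightarrow> complex) \<Rightarrow> (('d::finite) LP)^('d option)^('d option)" where
  "Mf v a = (\<chi> r c. (let g = (case c of None \<Rightarrow> fpoly v a | Some j \<Rightarrow> theta j (fpoly v a))
                     in (case r of None \<Rightarrow> g | Some i \<Rightarrow> theta i g)))"

definition Hf :: "('n::finite \<Rightarrow> int^('d::finite)) \<Rightarrow> ('n \<Rightarrow> complex) \<Rightarrow> ('d::finite) LP" where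
  "Hf v a = mon CARD('d) 0 * det (Mf v a)"

text \<open>R is the toric residue map S^d_Delta -> C (extended by 0 outside S^d_Delta)\<close>
definition is_toric_res :: "('n::finite \<Rightarrow> int^('d::finite)) \<Rightarrow> ('n \<Rightarrow> complex) \<Rightarrow> (('d::finite) LP \<Rightarrow> complex) \<Rightarrow> bool" where
  "is_toric_res v a R \<longleftrightarrow>
     (\<forall>g. \<not> in_Sk v CARD('d) g \<longrightarrow> R g = 0) \<and>
     (\<forall>g h. in_Sk v CARD('d) g \<and> in_Sk v CARD('d) h \<longrightarrow> R (g + h) = R g + R h) \<and>
     (\<forall>c g. in_Sk v CARD('d) g \<longrightarrow> R (cst c * g) = c * R g) \<and>
     (\<forall>h. in_Sk v (CARD('d) - 1) h \<longrightarrow> R (F0 v a * h) = 0) \<and>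
     (\<forall>i h. in_Sk v (CARD('d) - 1) h \<longrightarrow> R (Fi v a i * h) = 0) \<and>
     R (Hf v a) = complex_of_real (VolDelta v)"

definition toric_res :: "('n::finite \<Rightarrow> int^('d::finite)) \<Rightarrow> ('n \<Rightarrow> complex) \<Rightarrow> ('d::finite) LP \<Rightarrow> complex" where
  "toric_res v a = (THE R. is_toric_res v a R)"

text \<open>multivariate polynomials over Q in x_i (i :: 'n): exponent vectors => coefficients\<close>
definition homogeneous :: "(('n::finite \<Rightarrow>\<^sub>0 nat) \<Rightarrow>\<^sub>0 rat) \<Rightarrow> nat \<Rightarrow> bool" where
  "homogeneous P k \<longleftrightarrow> (\<forall>\<alpha>\<in>Poly_Mapping.keys P. (\<Sum>i\<in>UNIV. Poly_Mapping.lookup \<alpha> i) = k)"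

definition subst_t :: "('n::finite \<Rightarrow> int^('d::finite)) \<Rightarrow> ('n \<Rightarrow> complex)
     \<Rightarrow> (('n \<Rightarrow>\<^sub>0 nat) \<Rightarrow>\<^sub>0 rat) \<Rightarrow> ('d::finite) LP" where
  "subst_t v a P = (\<Sum>\<alpha>\<in>Poly_Mapping.keys P.
      Poly_Mapping.single (CARD('d), (\<Sum>i\<in>UNIV. int (Poly_Mapping.lookup \<alpha> i) *s v i))
        (of_rat (Poly_Mapping.lookup P \<alpha>) * (\<Prod>i\<in>UNIV. a i ^ Poly_Mapping.lookup \<alpha> i)))"

definition eval_mpoly :: "(('n::finite \<Rightarrow>\<^sub>0 nat) \<Rightarrow>\<^sub>0 rat) \<Rightarrow> ('n \<Rightarrow> complex) \<Rightarrow> complex" where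
  "eval_mpoly P x = (\<Sum>\<alpha>\<in>Poly_Mapping.keys P. of_rat (Poly_Mapping.lookup P \<alpha>) * (\<Prod>i\<in>UNIV. x i ^ Poly_Mapping.lookup \<alpha> i))"

end

theory Submission
  imports Defs
begin

text \<open>
  Let \<open>n = d + 1\<close>, \<open>W = \<Sum> w\<close>, \<open>z = t\<^sub>0\<close> and \<open>e i = t\<^sub>0 t^(v i)\<close>. The linear span of \<open>F\<^sub>0, \<dots>, F\<^sub>d\<close> is
  spanned by the elements \<open>a i e i - (w i / W) z\<close>. A monomial \<open>t\<^sub>0^k t^m\<close> has a unique integer
  representation \<open>m = \<Sum> c i v i\<close> with \<open>0 \<le> j < W\<close>, \<open>j = k - \<Sum> c i\<close>, and the functional
  \<open>\<phi>(t\<^sub>0^k t^m) = W^j \<Prod> (w i / a i)^(c i)\<close> annihilates the ideal in degree \<open>d\<close>, because multiplication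
  by \<open>e i\<close> leaves \<open>j\<close> fixed, multiplication by \<open>z\<close> increases it by one, and the class \<open>j = W - 1\<close> does
  not occur in degree \<open>d - 1\<close>. Conversely the relations \<open>a i e i = (w i / W) z\<close> move every monomial of
  degree \<open>d\<close> to the one with barycentric coordinates \<open>1 - w i / W\<close>, so the residue is a multiple of
  \<open>\<phi>\<close>; the multiple is found by evaluating \<open>\<phi>\<close> at \<open>H'\<close>. Regularity enters only through
  \<open>a i \<noteq> 0\<close>: if \<open>a i = 0\<close>, then no polynomial in \<open>e i\<close> lies in the ideal, and \<open>F\<^sub>0, \<dots>, F\<^sub>d, e i\<close> would be
  \<open>d + 2\<close> algebraically independent elements of a ring of dimension \<open>d + 1\<close>.
\<close>

section \<open>Determinants\<close>

text \<open>A row outside \<open>range \<beta>\<close> is zero off the diagonal, so only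
  permutations fixing those indices contribute to the Leibniz sum, and conjugation by
  \<open>\<beta>\<close> turns the remaining ones into permutations of \<open>'b\<close> with the
  same sign. For bijective \<open>\<beta>\<close> this is a change of index type, for
  \<open>\<beta> = Some\<close> a block formula.\<close>

lemma det_pad:
  fixes A :: "'r::comm_ring_1^'a::finite^'a" and \<beta> :: "'b::finite \<Rightarrow> 'a"
  assumes inj: "inj \<beta>" and z: "\<And>i j. i \<notin> range \<beta> \<Longrightarrow> i \<noteq> j \<Longrightarrow> A$i$j = 0"
  shows "det A = (\<Prod>i\<in>-range \<beta>. A$i$i) * det (\<chi> i j. A $ \<beta> i $ \<beta> j)"
proof -
  let ?t = "\<lambda>p. of_int (sign p) * (\<Prod>i\<in>UNIV. A$i$p i)"
  have bij: "bij_betw \<beta> UNIV (range \<beta>)"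
    using inj by (simp add: bij_betw_def)
  have "det A = sum ?t {p. p permutes range \<beta>}"
    unfolding det_def
  proof (rule sum.mono_neutral_right)
    show "finite {p::'a\<Rightarrow>'a. p permutes UNIV}" by (simp add: finite_permutations)
    show "{p. p permutes range \<beta>} \<subseteq> {p. p permutes UNIV}"
      by (auto intro: permutes_subset)
    show "\<forall>p\<in>{p. p permutes UNIV} - {p. p permutes range \<beta>}. ?t p = 0"
    proof
      fix p assume p: "p \<in> {p. p permutes UNIV} - {p. p permutes range \<beta>}"
      then obtain i where "i \<notin> range \<beta>" "p i \<noteq> i"
        by (auto simp: permutes_def)
      then have "A$i$p i = 0" using z by metis
      then have "(\<Prod>i\<in>UNIV. A$i$p i) = 0"
        by (intro prod_zero) auto
      then show "?t p = 0" by simp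
    qed
  qed
  also have "\<dots> = (\<Sum>q | q permutes UNIV. ?t (map_permutation UNIV \<beta> q))"
  proof (rule sum.reindex_bij_witness[where i = "map_permutation UNIV \<beta>"
        and j = "map_permutation (range \<beta>) (inv \<beta>)"])
    fix p assume p: "p \<in> {p. p permutes range \<beta>}"
    show "map_permutation UNIV \<beta> (map_permutation (range \<beta>) (inv \<beta>) p) = p"
      by (rule map_permutation_compose_inv)
        (use p inj in \<open>auto simp: bij_betw_def inj_on_def f_inv_into_f\<close>)
    show "map_permutation (range \<beta>) (inv \<beta>) p \<in> {q. q permutes UNIV}"
      using p inj by (auto intro!: map_permutation_permutes simp: bij_betw_def inj_on_def image_iff)
    show "?t (map_permutation UNIV \<beta> (map_permutation (range \<beta>) (inv \<beta>) p)) = ?t p"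
      using \<open>map_permutation UNIV \<beta> (map_permutation (range \<beta>) (inv \<beta>) p) = p\<close> by simp
  next
    fix q assume q: "q \<in> {q::'b\<Rightarrow>'b. q permutes UNIV}"
    show "map_permutation (range \<beta>) (inv \<beta>) (map_permutation UNIV \<beta> q) = q"
      by (rule map_permutation_compose_inv) (use q inj bij in auto)
    show "map_permutation UNIV \<beta> q \<in> {p. p permutes range \<beta>}"
      using q bij by (auto intro: map_permutation_permutes)
  qed
  also have "\<dots> = (\<Sum>q | q permutes UNIV. (\<Prod>i\<in>-range \<beta>. A$i$i) *
      (of_int (sign q) * (\<Prod>i\<in>UNIV. A $ \<beta> i $ \<beta> (q i))))"
  proof (rule sum.cong)
    fix q :: "'b \<Rightarrow> 'b" assume "q \<in> {q. q permutes UNIV}"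
    then have q: "q permutes UNIV" by simp
    let ?p = "map_permutation UNIV \<beta> q"
    have perm: "?p permutes range \<beta>" using map_permutation_permutes[OF bij q] .
    have "(\<Prod>i\<in>UNIV. A$i$?p i) = (\<Prod>i\<in>-range \<beta>. A$i$?p i) * (\<Prod>i\<in>range \<beta>. A$i$?p i)"
      by (subst prod.union_disjoint[symmetric]) (auto intro: prod.cong)
    also have "(\<Prod>i\<in>-range \<beta>. A$i$?p i) = (\<Prod>i\<in>-range \<beta>. A$i$i)"
      using permutes_not_in[OF perm] by (intro prod.cong) auto
    also have "(\<Prod>i\<in>range \<beta>. A$i$?p i) = (\<Prod>i\<in>UNIV. A $ \<beta> i $ \<beta> (q i))"
      using inj by (subst prod.reindex) (auto simp: map_permutation_apply)
    finally show "?t ?p = (\<Prod>i\<in>-range \<beta>. A$i$i) *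
      (of_int (sign q) * (\<Prod>i\<in>UNIV. A $ \<beta> i $ \<beta> (q i)))"
      using inj q by (subst sign_map_permutation) (auto simp: mult_ac)
  qed simp
  finally show ?thesis by (simp add: det_def sum_distrib_left)
qed

text \<open>Adding multiples of row \<open>k\<close> to other rows leaves the determinant alone, so
  the multiples of \<open>y\<close> in the rows of \<open>T\<close> can be inserted one at a time,
  starting from a matrix whose rows other than \<open>k\<close> are diagonal.\<close>

lemma det_diagonal_with_row:
  fixes D x :: "'a::finite \<Rightarrow> 'r::comm_ring_1" and y :: "'r^'a"
  assumes "finite T" "k \<notin> T"
  shows "det (\<chi> i. if i = k then y else if i \<in> T then D i *s axis i 1 + x i *s y else D i *s axis i 1)
    = y$k * (\<Prod>i\<in>-{k}. D i)"
  using assms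
proof (induction T)
  case empty
  have "det (\<chi> i. if i = k then y else D i *s axis i 1) =
    (\<Prod>i\<in>-range (\<lambda>_::1. k). (\<chi> i. if i = k then y else D i *s axis i 1)$i$i) * y$k"
    by (subst det_pad[of "\<lambda>_::1. k"]) (auto simp: inj_def axis_def det_1)
  also have "(\<Prod>i\<in>-range (\<lambda>_::1. k). (\<chi> i. if i = k then y else D i *s axis i 1)$i$i) = (\<Prod>i\<in>-{k}. D i)"
    by (intro prod.cong) (auto simp: axis_def)
  finally show ?case by (simp add: mult.commute cong: if_cong)
next
  case (insert j T)
  let ?A = "\<chi> i. if i = k then y else if i \<in> T then D i *s axis i 1 + x i *s y else D i *s axis i 1"
  have "(\<chi> i. if i = k then y else if i \<in> insert j T then D i *s axis i 1 + x i *s y else D i *s axis i 1)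
    = (\<chi> i. if i = j then row j ?A + x j *s row k ?A else row i ?A)"
    using insert by (auto simp: vec_eq_iff row_def)
  then show ?case using det_row_operation[of j k ?A "x j"] insert by auto
qed

text \<open>By multilinearity in the rows, a term with multiples of \<open>y\<close> in two rows
  vanishes, so at most one row contributes its rank one part. Products over \<open>-{k}\<close>
  stand in place of quotients by \<open>D k\<close>, because the entries will be Laurent
  polynomials.\<close>

lemma det_diagonal_plus_rank_one:
  fixes D x y :: "'a::finite \<Rightarrow> 'r::comm_ring_1"
  shows "det (\<chi> i j. (if i = j then D i else 0) + x i * y j)
    = (\<Prod>i\<in>UNIV. D i) + (\<Sum>k\<in>UNIV. x k * y k * (\<Prod>i\<in>-{k}. D i))"
proof -
  let ?y = "\<chi> j. y j"
  have "det (\<chi> i. if i \<in> T then D i *s axis i 1 + x i *s ?y else D i *s axis i 1)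
    = (\<Prod>i\<in>UNIV. D i) + (\<Sum>k\<in>T. x k * y k * (\<Prod>i\<in>-{k}. D i))" for T :: "'a set"
    using finite[of T]
  proof (induction T)
    case empty
    show ?case by (simp add: det_diagonal axis_def)
  next
    case (insert k T)
    let ?r = "\<lambda>i. if i \<in> T then D i *s axis i 1 + x i *s ?y else D i *s axis i 1"
    have "(\<chi> i. if i \<in> insert k T then D i *s axis i 1 + x i *s ?y else D i *s axis i 1)
      = (\<chi> i. if i = k then D i *s axis i 1 + x i *s ?y else ?r i)"
      by (auto simp: vec_eq_iff)
    then have "det (\<chi> i. if i \<in> insert k T then D i *s axis i 1 + x i *s ?y else D i *s axis i 1)
      = det (\<chi> i. if i = k then D i *s axis i 1 else ?r i) + det (\<chi> i. if i = k then x i *s ?y else ?r i)"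
      by (simp only: det_row_add)
    also have "(\<chi> i. if i = k then D i *s axis i 1 else ?r i) = (\<chi> i. ?r i)"
      using insert by (auto simp: vec_eq_iff)
    also have "(\<chi> i. if i = k then x i *s ?y else ?r i) = (\<chi> i. if i = k then x k *s ?y else ?r i)"
      by (auto simp: vec_eq_iff)
    also have "det (\<chi> i. if i = k then x k *s ?y else ?r i) = x k * (y k * (\<Prod>i\<in>-{k}. D i))"
      using det_diagonal_with_row[OF insert(1,2), of ?y D x] by (simp only: det_row_mul) simp
    finally show ?case using insert by (simp add: algebra_simps)
  qed
  from this[of UNIV] have "det (\<chi> i. D i *s axis i 1 + x i *s ?y)
    = (\<Prod>i\<in>UNIV. D i) + (\<Sum>k\<in>UNIV. x k * y k * (\<Prod>i\<in>-{k}. D i))"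
    by simp
  moreover have "(\<chi> i. D i *s axis i 1 + x i *s ?y) = (\<chi> i j. (if i = j then D i else 0) + x i * y j)"
    by (auto simp: vec_eq_iff axis_def)
  ultimately show ?thesis by simp
qed

section \<open>The volume of a simplex\<close>

text \<open>The change of variables formula behind \<open>content_simplex\<close> needs a well-ordered index type;
  \<open>idx\<close> provides one with as many elements as a given finite type.\<close>

typedef (overloaded) ('a::finite) idx = "{..<CARD('a)}"
  by (intro exI[of _ 0]) simp

instance idx :: (finite) finite
proof
  show "finite (UNIV :: 'a idx set)"
    using type_definition.univ[OF type_definition_idx] by (metis finite_imageI finite_lessThan)
qed

instantiation idx :: (finite) wellorder
begin

definition "less_eq_idx (i :: 'a idx) (j :: 'a idx) \<longleftrightarrow> Rep_idx i \<le> Rep_idx j"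
definition "less_idx (i :: 'a idx) (j :: 'a idx) \<longleftrightarrow> Rep_idx i < Rep_idx j"

instance
proof
  fix P :: "'a idx \<Rightarrow> bool" and i
  assume step: "\<And>i. (\<And>j. j < i \<Longrightarrow> P j) \<Longrightarrow> P i"
  show "P i"
  proof (induction "Rep_idx i" arbitrary: i rule: less_induct)
    case less
    show ?case by (rule step) (simp add: less less_idx_def)
  qed
qed (auto simp: less_eq_idx_def less_idx_def Rep_idx_inject)

end

lemma card_idx: "CARD('a::finite idx) = CARD('a)"
  by (simp add: type_definition.card[OF type_definition_idx])

text \<open>Relabelling coordinates turns boxes into boxes with the same side lengths, and the
  values on boxes determine Lebesgue measure.\<close>

lemma lborel_distr_reindex:
  fixes \<beta> :: "'a::finite \<Rightarrow> 'b::finite"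
  assumes "bij \<beta>"
  shows "distr lborel borel (\<lambda>x :: real^'b. \<chi> i. x $ \<beta> i) = (lborel :: (real^'a) measure)"
proof (rule lborel_eqI[symmetric])
  let ?T = "\<lambda>x :: real^'b. \<chi> i. x $ \<beta> i"
  have m: "?T \<in> borel_measurable lborel"
    unfolding measurable_lborel2 by (intro borel_measurable_continuous_onI continuous_intros)
  fix l u :: "real^'a" assume le: "\<And>b. b \<in> Basis \<Longrightarrow> l \<bullet> b \<le> u \<bullet> b"
  have le': "l $ i \<le> u $ i" for i
    using le[of "axis i 1"] by (simp add: inner_axis axis_in_Basis_iff)
  have surj: "(\<forall>i. P (\<beta> i)) \<longleftrightarrow> (\<forall>j. P j)" for P
    using assms by (metis bij_pointE)
  define l' u' where "l' = (\<chi> j. l $ inv \<beta> j)" and "u' = (\<chi> j. u $ inv \<beta> j)"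
  have b: "inv \<beta> (\<beta> i) = i" for i using assms by (simp add: bij_is_inj)
  have "emeasure (distr lborel borel ?T) (box l u) = emeasure lborel (?T -` box l u)"
    using m by (subst emeasure_distr) auto
  also have "?T -` box l u = box l' u'"
  proof -
    have "(\<forall>i. l $ i < x $ \<beta> i \<and> x $ \<beta> i < u $ i) \<longleftrightarrow> (\<forall>j. l' $ j < x $ j \<and> x $ j < u' $ j)" for x :: "real^'b"
      using surj[of "\<lambda>j. l' $ j < x $ j \<and> x $ j < u' $ j"] by (simp add: l'_def u'_def b)
    then show ?thesis by (auto simp: mem_box_cart)
  qed
  also have "emeasure lborel (box l' u') = ennreal (\<Prod>j\<in>UNIV. u' $ j - l' $ j)"
  proof -
    have "\<forall>b\<in>Basis. l' \<bullet> b \<le> u' \<bullet> b"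
      using le' by (auto simp: Basis_vec_def inner_axis l'_def u'_def)
    then have "emeasure lborel (box l' u') = ennreal (\<Prod>b\<in>Basis. (u' - l') \<bullet> b)"
      by (simp add: emeasure_lborel_box_eq)
    also have "(\<Prod>b\<in>Basis. (u' - l') \<bullet> b) = (\<Prod>j\<in>UNIV. u' $ j - l' $ j)"
      by (simp add: Basis_vec_def inner_axis UNION_singleton_eq_range prod.reindex inj_on_def axis_eq_axis)
    finally show ?thesis .
  qed
  also have "(\<Prod>j\<in>UNIV. u' $ j - l' $ j) = (\<Prod>i\<in>UNIV. u $ i - l $ i)"
    by (subst prod.reindex_bij_betw[OF assms, symmetric]) (simp add: l'_def u'_def b)
  also have "\<dots> = (\<Prod>b\<in>Basis. (u - l) \<bullet> b)"
    by (simp add: Basis_vec_def inner_axis UNION_singleton_eq_range prod.reindex inj_on_def axis_eq_axis)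
  finally show "emeasure (distr lborel borel ?T) (box l u) = (\<Prod>b\<in>Basis. (u - l) \<bullet> b)" .
qed simp

text \<open>Relabelling the coordinates by a bijection with \<open>'d idx\<close> respects convex
  hulls and volume, so \<open>content_simplex\<close> carries over; \<open>det_pad\<close> relabels
  the determinant back.\<close>

lemma content_simplex_finite:
  fixes X :: "(real^'d::finite) set" and f :: "'d \<Rightarrow> real^'d"
  assumes fin: "finite X" and card: "card X = Suc CARD('d)"
    and x0: "x0 \<in> X" and bij: "bij_betw f UNIV (X - {x0})"
  shows "measure lborel (convex hull X) = \<bar>det (\<chi> i j. f j $ i - x0 $ i)\<bar> / fact CARD('d)"
proof -
  obtain \<beta> :: "'d idx \<Rightarrow> 'd" where \<beta>: "bij \<beta>"
    using finite_same_card_bij[of "UNIV :: 'd idx set" "UNIV :: 'd set"] card_idx by auto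
  define T :: "real^'d \<Rightarrow> real^'d idx" where "T = (\<lambda>x. \<chi> i. x $ \<beta> i)"
  have lin: "linear T" by (auto simp: T_def linear_iff vec_eq_iff)
  have inj: "inj T"
    using \<beta> by (auto simp: T_def inj_def vec_eq_iff) (metis bij_pointE)
  have m: "T \<in> borel_measurable lborel"
    using linear_continuous_on[of T UNIV] lin
    unfolding measurable_lborel2 by (intro borel_measurable_continuous_onI) (simp add: linear_linear)
  have cl: "closed (convex hull (T ` X))"
    using fin by (intro compact_imp_closed finite_imp_compact_convex_hull) auto
  have "measure lborel (convex hull (T ` X)) = measure (distr lborel borel T) (convex hull (T ` X))"
    using lborel_distr_reindex[OF \<beta>] by (simp add: T_def)
  also have "\<dots> = measure lborel (T -` (convex hull (T ` X)))"
    using m cl by (subst measure_distr) auto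
  also have "T -` (convex hull (T ` X)) = convex hull X"
    using inj lin by (simp add: convex_hull_linear_image[symmetric] inj_vimage_image_eq)
  finally have "measure lborel (convex hull X) = measure lborel (convex hull (T ` X))" by simp
  also have "\<dots> = \<bar>det (\<chi> i. \<chi> j. T (f (\<beta> j)) $ i - T x0 $ i)\<bar> / fact CARD('d idx)"
  proof (rule content_simplex)
    show "card (T ` X) = Suc CARD('d idx)"
      using card inj by (simp add: card_image inj_on_subset card_idx)
    have "inj f" and rf: "range f = X - {x0}" using bij by (auto simp: bij_betw_def)
    have "inj (T \<circ> (f \<circ> \<beta>))"
      using inj \<open>inj f\<close> bij_is_inj[OF \<beta>] by (intro inj_compose)
    moreover have "range (T \<circ> (f \<circ> \<beta>)) = T ` X - {T x0}"
      using rf bij_is_surj[OF \<beta>] inj x0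
      by (simp only: image_comp[symmetric]) (simp add: image_set_diff)
    ultimately show "bij_betw (\<lambda>j. T (f (\<beta> j))) UNIV (T ` X - {T x0})"
      by (simp add: bij_betw_def o_def)
  qed (use fin x0 in auto)
  also have "det (\<chi> i. \<chi> j. T (f (\<beta> j)) $ i - T x0 $ i) = det (\<chi> i j. f j $ i - x0 $ i)"
    using det_pad[of \<beta> "\<chi> i j. f j $ i - x0 $ i"] \<beta>
    by (simp add: T_def bij_is_inj bij_is_surj)
  finally show ?thesis by (simp add: card_idx)
qed

section \<open>The lattice of a weighted simplex\<close>

text \<open>The \<open>d + 1\<close> vectors \<open>v i\<close> span a space of dimension
  \<open>d\<close>, so their relations form a line. A relation not proportional to \<open>w\<close>
  would, together with \<open>w\<close>, express two of the vectors through the other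
  \<open>d - 1\<close>.\<close>

lemma relation_unique:
  fixes w :: "'n::finite \<Rightarrow> nat" and v :: "'n \<Rightarrow> int^'d::finite" and x :: "'n \<Rightarrow> real"
  assumes card: "CARD('n) = CARD('d) + 1"
    and wpos: "\<forall>i. 0 < w i"
    and vgen: "\<forall>m :: int^'d. \<exists>c :: 'n \<Rightarrow> int. m = (\<Sum>i\<in>UNIV. c i *s v i)"
    and vrel: "(\<Sum>i\<in>UNIV. int (w i) *s v i) = 0"
    and x: "\<And>l. (\<Sum>i\<in>UNIV. x i * of_int (v i $ l)) = 0"
  shows "\<exists>s. \<forall>i. x i = s * real (w i)"
proof (rule ccontr)
  assume no: "\<nexists>s. \<forall>i. x i = s * real (w i)"
  obtain i0 :: 'n where True by simp
  \<comment> \<open>Normalised to vanish at \<open>i0\<close>: this relation eliminates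
    \<open>v i1\<close> without involving \<open>v i0\<close>, after which the relation
    \<open>w\<close> eliminates \<open>v i0\<close>.\<close>
  define x' where "x' = (\<lambda>i. x i - x i0 / w i0 * w i)"
  have "\<exists>i. x i \<noteq> x i0 / real (w i0) * real (w i)" using no by blast
  then obtain i1 where i1: "x' i1 \<noteq> 0" by (auto simp: x'_def)
  have x'0: "x' i0 = 0" using wpos[rule_format, of i0] by (simp add: x'_def)
  then have ne: "i1 \<noteq> i0" using i1 by auto
  define B where "B = (\<lambda>i. rvec (v i)) ` (- {i0, i1})"
  have relw: "(\<Sum>i\<in>UNIV. real (w i) *\<^sub>R rvec (v i)) = 0"
  proof -
    have "(\<Sum>i\<in>UNIV. real (w i) * of_int (v i $ l)) = 0" for l
    proof -
      have "of_int ((\<Sum>i\<in>UNIV. int (w i) *s v i) $ l) = (0::real)" by (simp add: vrel)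
      then show ?thesis by simp
    qed
    then show ?thesis by (simp add: vec_eq_iff rvec_def)
  qed
  have relx: "(\<Sum>i\<in>UNIV. x' i *\<^sub>R rvec (v i)) = 0"
  proof -
    have "(\<Sum>i\<in>UNIV. x' i *\<^sub>R rvec (v i)) = (\<Sum>i\<in>UNIV. x i *\<^sub>R rvec (v i)) - (x i0 / w i0) *\<^sub>R (\<Sum>i\<in>UNIV. real (w i) *\<^sub>R rvec (v i))"
      by (simp add: x'_def sum_subtractf scaleR_sum_right algebra_simps)
    also have "(\<Sum>i\<in>UNIV. x i *\<^sub>R rvec (v i)) = 0" by (simp add: vec_eq_iff rvec_def x)
    finally show ?thesis by (simp add: relw)
  qed
  have "x' i1 *\<^sub>R rvec (v i1) = - (\<Sum>i\<in>-{i0,i1}. x' i *\<^sub>R rvec (v i))"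
  proof -
    have "(\<Sum>i\<in>UNIV. x' i *\<^sub>R rvec (v i)) = (\<Sum>i\<in>-{i0,i1}. x' i *\<^sub>R rvec (v i)) + (\<Sum>i\<in>{i0,i1}. x' i *\<^sub>R rvec (v i))"
      by (subst sum.union_disjoint[symmetric]) (auto intro: sum.cong)
    then show ?thesis using relx x'0 ne by (simp add: algebra_simps eq_neg_iff_add_eq_0)
  qed
  moreover have "- (\<Sum>i\<in>-{i0,i1}. x' i *\<^sub>R rvec (v i)) \<in> span B"
    unfolding B_def by (intro span_neg span_sum span_scale span_base) auto
  ultimately have "x' i1 *\<^sub>R rvec (v i1) \<in> span B" by simp
  then have b1: "rvec (v i1) \<in> span B"
    using i1 span_scale[of "x' i1 *\<^sub>R rvec (v i1)" B "1 / x' i1"] by simp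
  have "real (w i0) *\<^sub>R rvec (v i0) = - (\<Sum>i\<in>-{i0}. real (w i) *\<^sub>R rvec (v i))"
  proof -
    have "(\<Sum>i\<in>UNIV. real (w i) *\<^sub>R rvec (v i)) = (\<Sum>i\<in>-{i0}. real (w i) *\<^sub>R rvec (v i)) + (\<Sum>i\<in>{i0}. real (w i) *\<^sub>R rvec (v i))"
      unfolding Compl_eq_Diff_UNIV by (rule sum.subset_diff) auto
    then show ?thesis using relw by (simp add: algebra_simps eq_neg_iff_add_eq_0)
  qed
  moreover have B: "rvec (v i) \<in> span B" if "i \<noteq> i0" for i
    using that b1 unfolding B_def by (cases "i = i1") (auto intro: span_base)
  then have "- (\<Sum>i\<in>-{i0}. real (w i) *\<^sub>R rvec (v i)) \<in> span B"
    by (intro span_neg span_sum span_scale) auto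
  ultimately have "real (w i0) *\<^sub>R rvec (v i0) \<in> span B" by simp
  then have "rvec (v i0) \<in> span B"
    using wpos[rule_format, of i0] span_scale[of "real (w i0) *\<^sub>R rvec (v i0)" B "1 / w i0"] by simp
  with B have B: "rvec (v i) \<in> span B" for i by (cases "i = i0") auto
  \<comment> \<open>The \<open>v i\<close> generate the lattice, so the unit vectors, and with them
    the whole space, lie in the span of at most \<open>d - 1\<close> vectors.\<close>
  have "axis l 1 \<in> span B" for l
  proof -
    obtain c where c: "axis l 1 = (\<Sum>i\<in>UNIV. c i *s v i)" using vgen by blast
    have "(axis l 1 :: real^'d) $ k = (\<Sum>i\<in>UNIV. real_of_int (c i) *\<^sub>R rvec (v i)) $ k" for k
    proof -
      have "real_of_int ((axis l 1 :: int^'d) $ k) = of_int ((\<Sum>i\<in>UNIV. c i *s v i) $ k)"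
        by (simp only: c)
      then show ?thesis by (auto simp: rvec_def axis_def split: if_splits)
    qed
    then have "axis l 1 = (\<Sum>i\<in>UNIV. real_of_int (c i) *\<^sub>R rvec (v i))"
      by (simp add: vec_eq_iff)
    also have "\<dots> \<in> span B" by (intro span_sum span_scale B)
    finally show ?thesis .
  qed
  then have "(Basis :: (real^'d) set) \<subseteq> span B" by (auto simp: Basis_vec_def)
  then have "span B = UNIV" by (metis span_Basis span_minimal subspace_span top.extremum_uniqueI)
  then have "DIM(real^'d) \<le> card B"
    by (metis B_def dim_UNIV dim_le_card' dim_span finite finite_imageI)
  also have "card B \<le> card (-{i0,i1})" unfolding B_def by (rule card_image_le) simp
  also have "\<dots> = CARD('n) - 2" using ne by (simp add: Compl_eq_Diff_UNIV card_Diff_subset)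
  finally show False using card zero_less_card_finite[where 'a='d] by simp
qed

text \<open>In lowest terms the denominator of \<open>s\<close> divides every \<open>w j\<close>,
  hence their gcd. Together with \<open>relation_unique\<close> this makes every integer relation an
  integer multiple of \<open>w\<close>.\<close>

lemma int_multiple_of_coprime:
  fixes w :: "'n::finite \<Rightarrow> nat" and r :: "'n \<Rightarrow> int" and s :: real
  assumes wpos: "\<forall>i. 0 < w i" and wgcd: "Gcd (range w) = 1"
    and r: "\<And>j. of_int (r j) = s * real (w j)"
  shows "s \<in> \<int>"
proof -
  obtain j0 :: 'n where True by simp
  have "s = of_int (r j0) / of_nat (w j0)"
    using r[of j0] wpos[rule_format, of j0] by (simp add: field_simps)
  then have "s \<in> \<rat>" by simp
  then obtain a b :: int where ab: "b > 0" "coprime a b" "s = of_int a / of_int b"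
    by (metis Rats_cases' of_int_0_less_iff)
  have "b dvd int (w j)" for j
  proof -
    have "real_of_int (r j * b) = of_int (a * int (w j))" using r[of j] ab by (simp add: field_simps)
    then have "r j * b = a * int (w j)" by (simp only: of_int_eq_iff)
    then have "b dvd a * int (w j)" by (metis dvd_triv_right)
    then show ?thesis using ab(2) by (simp add: coprime_commute coprime_dvd_mult_right_iff)
  qed
  then have "nat b dvd w j" for j using ab(1) by (simp add: nat_dvd_iff)
  then have "nat b dvd Gcd (range w)" by (intro Gcd_greatest) auto
  then have "b = 1" using wgcd ab(1) by simp
  then show ?thesis using ab by simp
qed

text \<open>The integer vectors \<open>C l\<close> and \<open>s\<close> split the presentation \<open>\<int>\<^sup>n/\<int>w \<cong> M\<close>: the square
  matrix with rows \<open>(v i, s i)\<close> is inverse to the one with rows \<open>C l\<close> and \<open>w\<close>.\<close>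

locale split_simplex =
  fixes w :: "'n::finite \<Rightarrow> nat" and v :: "'n \<Rightarrow> int^'d::finite"
    and C :: "'d \<Rightarrow> 'n \<Rightarrow> int" and s :: "'n \<Rightarrow> int"
  assumes card: "CARD('n) = CARD('d) + 1"
    and wpos: "0 < w i"
    and wdvd: "w i dvd (\<Sum>j\<in>UNIV. w j)"
    and split: "(\<Sum>l\<in>UNIV. v i $ l * C l j) + s i * int (w j) = (if i = j then 1 else 0)"
    and sect: "(\<Sum>j\<in>UNIV. C l j * v j $ k) = (if l = k then 1 else 0)"
    and relation: "(\<Sum>i\<in>UNIV. int (w i) * v i $ l) = 0"

text \<open>\<open>C l\<close> is an integer lift of the unit vector of index \<open>l\<close>.
  Subtracting the lift of \<open>v i\<close> from the unit vector of index \<open>i\<close> in the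
  space of coefficient vectors leaves a relation, hence an integer multiple of \<open>w\<close>;
  this multiple is \<open>s i\<close>.\<close>

lemma split_simplex_exists:
  fixes w :: "'n::finite \<Rightarrow> nat" and v :: "'n \<Rightarrow> int^'d::finite"
  assumes card: "CARD('n) = CARD('d) + 1"
    and wpos: "\<forall>i. 0 < w i"
    and wgcd: "Gcd (range w) = 1"
    and wdvd: "\<forall>i. w i dvd (\<Sum>j\<in>UNIV. w j)"
    and vgen: "\<forall>m :: int^'d. \<exists>c :: 'n \<Rightarrow> int. m = (\<Sum>i\<in>UNIV. c i *s v i)"
    and vrel: "(\<Sum>i\<in>UNIV. int (w i) *s v i) = 0"
  shows "\<exists>C s. split_simplex w v C s"
proof -
  have "\<forall>l. \<exists>c. axis l 1 = (\<Sum>i\<in>UNIV. c i *s v i)"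
    using vgen by blast
  from choice[OF this] obtain C where C: "\<And>l. axis l 1 = (\<Sum>i\<in>UNIV. C l i *s v i)"
    by blast
  have sec: "(\<Sum>j\<in>UNIV. C l j * v j $ k) = (if l = k then 1 else 0)" for l k
    using arg_cong[OF C[of l], of "\<lambda>x. x $ k"] by (simp add: axis_def eq_commute)
  have rel: "(\<Sum>i\<in>UNIV. int (w i) * v i $ l) = 0" for l
    using arg_cong[OF vrel, of "\<lambda>x. x $ l"] by simp
  define r where "r = (\<lambda>i j. (if i = j then 1 else 0) - (\<Sum>l\<in>UNIV. v i $ l * C l j))"
  have ker: "(\<Sum>j\<in>UNIV. r i j * v j $ k) = 0" for i k
  proof -
    have "(\<Sum>j\<in>UNIV. r i j * v j $ k) = v i $ k - (\<Sum>j\<in>UNIV. \<Sum>l\<in>UNIV. v i $ l * C l j * v j $ k)"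
      by (simp add: r_def left_diff_distrib sum_subtractf sum_distrib_right if_distrib[of "\<lambda>x. x * _"] cong: if_cong)
    also have "(\<Sum>j\<in>UNIV. \<Sum>l\<in>UNIV. v i $ l * C l j * v j $ k) = (\<Sum>l\<in>UNIV. v i $ l * (\<Sum>j\<in>UNIV. C l j * v j $ k))"
      by (subst sum.swap) (simp add: sum_distrib_left mult_ac)
    also have "\<dots> = v i $ k" by (simp add: sec if_distrib cong: if_cong)
    finally show ?thesis by simp
  qed
  have "\<exists>s. \<forall>j. r i j = s * int (w j)" for i
  proof -
    have "\<exists>t. \<forall>j. real_of_int (r i j) = t * real (w j)"
    proof (rule relation_unique[OF card wpos vgen vrel])
      fix l
      have "(\<Sum>j\<in>UNIV. real_of_int (r i j) * of_int (v j $ l)) = of_int (\<Sum>j\<in>UNIV. r i j * v j $ l)"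
        by simp
      then show "(\<Sum>j\<in>UNIV. real_of_int (r i j) * of_int (v j $ l)) = 0" by (simp only: ker of_int_0)
    qed
    then obtain t where t: "\<And>j. real_of_int (r i j) = t * real (w j)" by auto
    obtain t' where "t = of_int t'" using int_multiple_of_coprime[OF wpos wgcd t] by (auto elim: Ints_cases)
    with t have "real_of_int (r i j) = of_int (t' * int (w j))" for j by simp
    then show ?thesis by (metis of_int_eq_iff)
  qed
  then obtain s where s: "\<And>i j. r i j = s i * int (w j)" by metis
  have "split_simplex w v C s"
  proof
    show "(\<Sum>l\<in>UNIV. v i $ l * C l j) + s i * int (w j) = (if i = j then 1 else 0)" for i j
      using s[of i j] by (simp add: r_def)
  qed (use assms sec rel in auto)
  then show ?thesis by blast
qed

section \<open>The lattice of relations and barycentric coordinates\<close>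

context split_simplex
begin

definition W :: nat where "W = (\<Sum>j\<in>UNIV. w j)"

lemma W_pos: "0 < W"
  unfolding W_def using wpos by (intro sum_pos) auto

lemma relation_ring: "(\<Sum>i\<in>UNIV. of_nat (w i) * of_int (v i $ l)) = (0::'r::comm_ring_1)"
proof -
  have "(\<Sum>i\<in>UNIV. of_nat (w i) * of_int (v i $ l)) = (of_int (\<Sum>i\<in>UNIV. int (w i) * v i $ l) :: 'r)"
    by simp
  then show ?thesis by (simp only: relation) simp
qed

text \<open>Applied to the coefficient vector \<open>x\<close>, the identity \<open>split\<close>
  loses its part through \<open>v\<close>, and \<open>s\<close> reads off the multiplier. The ring
  is left arbitrary because integer, real and complex relations all occur below.\<close>

lemma kernel:
  fixes x :: "'n \<Rightarrow> 'r::comm_ring_1"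
  assumes "\<And>l. (\<Sum>i\<in>UNIV. x i * of_int (v i $ l)) = 0"
  shows "x j = (\<Sum>i\<in>UNIV. x i * of_int (s i)) * of_nat (w j)"
proof -
  have "x j = (\<Sum>i\<in>UNIV. x i * of_int (if i = j then 1 else 0))" by (simp add: if_distrib cong: if_cong)
  also have "\<dots> = (\<Sum>i\<in>UNIV. x i * of_int ((\<Sum>l\<in>UNIV. v i $ l * C l j) + s i * int (w j)))"
    by (simp only: split)
  also have "\<dots> = (\<Sum>i\<in>UNIV. \<Sum>l\<in>UNIV. x i * of_int (v i $ l) * of_int (C l j)) + (\<Sum>i\<in>UNIV. x i * of_int (s i)) * of_nat (w j)"
    by (simp add: algebra_simps sum.distrib sum_distrib_left sum_distrib_right)
  also have "(\<Sum>i\<in>UNIV. \<Sum>l\<in>UNIV. x i * of_int (v i $ l) * of_int (C l j)) = (\<Sum>l\<in>UNIV. (\<Sum>i\<in>UNIV. x i * of_int (v i $ l)) * of_int (C l j))"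
    by (subst sum.swap) (simp add: sum_distrib_right)
  also have "\<dots> = 0" by (simp add: assms)
  finally show ?thesis by simp
qed

text \<open>A linear choice of integer coordinates through the lifts \<open>C l\<close>; any other
  choice differs by a multiple of \<open>w\<close>.\<close>

definition rep :: "int^'d \<Rightarrow> 'n \<Rightarrow> int" where
  "rep m j = (\<Sum>l\<in>UNIV. m $ l * C l j)"

lemma rep: "(\<Sum>j\<in>UNIV. rep m j * v j $ k) = m $ k"
proof -
  have "(\<Sum>j\<in>UNIV. rep m j * v j $ k) = (\<Sum>l\<in>UNIV. m $ l * (\<Sum>j\<in>UNIV. C l j * v j $ k))"
    unfolding rep_def sum_distrib_right sum_distrib_left by (subst sum.swap) (simp add: mult_ac)
  then show ?thesis by (simp add: sect if_distrib cong: if_cong)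
qed

text \<open>Real coordinates of \<open>(k, m)\<close> with respect to the vectors
  \<open>(1, v i)\<close>. Signs are left free, so that the cone is cut out by nonnegativity of the
  one possible \<open>x\<close>.\<close>

definition bary :: "('n \<Rightarrow> real) \<Rightarrow> real \<Rightarrow> int^'d \<Rightarrow> bool" where
  "bary x k m \<longleftrightarrow> (\<Sum>i\<in>UNIV. x i) = k \<and> (\<forall>l. (\<Sum>i\<in>UNIV. x i * of_int (v i $ l)) = of_int (m $ l))"

text \<open>The difference of two solutions is a relation, hence \<open>t\<close> times
  \<open>w\<close>; its total is \<open>t * W\<close> and must be zero.\<close>

lemma bary_unique:
  assumes "bary x k m" "bary y k m" shows "x = y"
proof
  fix j
  let ?d = "\<lambda>i. x i - y i"
  define t where "t = (\<Sum>i\<in>UNIV. ?d i * of_int (s i))"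
  have d: "?d j = t * of_nat (w j)" for j
    unfolding t_def using assms by (intro kernel) (simp add: bary_def left_diff_distrib sum_subtractf)
  have "0 = (\<Sum>j\<in>UNIV. ?d j)" using assms by (simp add: bary_def sum_subtractf)
  also have "\<dots> = t * real W" unfolding d by (simp add: sum_distrib_left W_def)
  finally have "t = 0" using W_pos by simp
  then show "x j = y j" using d[of j] by simp
qed

lemma bary_add: "bary x k m \<Longrightarrow> bary y k' m' \<Longrightarrow> bary (\<lambda>i. x i + y i) (k + k') (m + m')"
  by (simp add: bary_def distrib_right sum.distrib)

lemma bary_vertex: "bary (\<lambda>j. if j = i then 1 else 0) 1 (v i)"
  by (simp add: bary_def if_distrib[of "\<lambda>x. x * _"] cong: if_cong)

text \<open>The relation among the vertices, divided by its total \<open>W\<close>, places the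
  origin in the interior of the simplex.\<close>

lemma bary_centre: "bary (\<lambda>i. w i / W) 1 0"
proof -
  have "(\<Sum>i\<in>UNIV. real (w i) / W * of_int (v i $ l)) = 0" for l
  proof -
    have "(\<Sum>i\<in>UNIV. real (w i) / W * of_int (v i $ l)) = (\<Sum>i\<in>UNIV. of_nat (w i) * of_int (v i $ l)) / W"
      by (simp add: sum_divide_distrib)
    then show ?thesis using relation_ring[of l, where 'r=real] by simp
  qed
  moreover have "(\<Sum>i\<in>UNIV. real (w i) / W) = 1"
  proof -
    have "(\<Sum>i\<in>UNIV. real (w i) / W) = real W / real W"
      by (simp add: sum_divide_distrib[symmetric] W_def)
    then show ?thesis using W_pos by simp
  qed
  ultimately show ?thesis by (simp add: bary_def)
qed

lemma inj_v: "inj v"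
proof (rule injI, rule ccontr)
  fix i j assume eq: "v i = v j" and ne: "i \<noteq> j"
  have "(\<lambda>l. if l = i then 1 else 0) = (\<lambda>l. if l = j then 1 else (0::real))"
    using bary_vertex[of i] bary_vertex[of j] eq by (intro bary_unique[of _ 1 "v i"]) auto
  then show False using ne by (metis zero_neq_one)
qed

text \<open>Turns the support condition of \<open>S\<close> into signs of barycentric coordinates,
  which simply add when monomials are multiplied.\<close>

lemma cone_iff: "rvec m \<in> (\<lambda>x. real k *\<^sub>R x) ` Delta v \<longleftrightarrow> (\<exists>x. (\<forall>i. 0 \<le> x i) \<and> bary x k m)"
proof -
  have inj: "inj (\<lambda>i. rvec (v i))"
    using inj_v by (auto simp: inj_def rvec_def vec_eq_iff)
  have D: "Delta v = {y. \<exists>u. (\<forall>i. 0 \<le> u i) \<and> sum u UNIV = 1 \<and> (\<Sum>i\<in>UNIV. u i *\<^sub>R rvec (v i)) = y}" (is "_ = ?R")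
  proof
    show "Delta v \<subseteq> ?R"
    proof
      fix y assume "y \<in> Delta v"
      then obtain u where u: "\<forall>x\<in>range (\<lambda>i. rvec (v i)). 0 \<le> u x" "sum u (range (\<lambda>i. rvec (v i))) = 1"
        "(\<Sum>x\<in>range (\<lambda>i. rvec (v i)). u x *\<^sub>R x) = y"
        unfolding Delta_def by (subst (asm) convex_hull_finite) auto
      then show "y \<in> ?R"
        using inj by (auto simp: sum.reindex intro!: exI[of _ "\<lambda>i. u (rvec (v i))"])
    qed
    show "?R \<subseteq> Delta v"
    proof
      fix y assume "y \<in> ?R"
      then obtain u where u: "\<forall>i. 0 \<le> u i" "sum u UNIV = 1" "(\<Sum>i\<in>UNIV. u i *\<^sub>R rvec (v i)) = y" by auto
      show "y \<in> Delta v"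
        unfolding Delta_def u(3)[symmetric] using u
        by (intro convex_sum) (auto intro: hull_inc)
    qed
  qed
  show ?thesis
  proof
    assume "rvec m \<in> (\<lambda>x. real k *\<^sub>R x) ` Delta v"
    then obtain u where u: "\<forall>i. 0 \<le> u i" "sum u UNIV = 1" "rvec m = real k *\<^sub>R (\<Sum>i\<in>UNIV. u i *\<^sub>R rvec (v i))"
      unfolding D by auto
    have "(\<Sum>i\<in>UNIV. real k * u i * of_int (v i $ l)) = of_int (m $ l)" for l
      using arg_cong[OF u(3), of "\<lambda>x. x $ l"] by (simp add: rvec_def sum_distrib_left mult_ac)
    then have "bary (\<lambda>i. real k * u i) k m"
      using u(2) by (simp add: bary_def sum_distrib_left[symmetric])
    then show "\<exists>x. (\<forall>i. 0 \<le> x i) \<and> bary x k m" using u(1) by (intro exI[of _ "\<lambda>i. real k * u i"]) auto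
  next
    assume "\<exists>x. (\<forall>i. 0 \<le> x i) \<and> bary x k m"
    then obtain x where x: "\<forall>i. 0 \<le> x i" "bary x k m" by blast
    show "rvec m \<in> (\<lambda>x. real k *\<^sub>R x) ` Delta v"
    \<comment> \<open>In degree zero the coordinates cannot be divided by \<open>k\<close>;
      nonnegative coordinates of total zero vanish, and the scaled simplex is the origin.\<close>
    proof (cases "k = 0")
      case True
      have "\<forall>i\<in>UNIV. x i = 0"
        using x True by (subst sum_nonneg_eq_0_iff[symmetric]) (auto simp: bary_def)
      then have "rvec m = 0" using x(2) by (simp add: bary_def rvec_def vec_eq_iff)
      moreover have "Delta v \<noteq> {}" by (simp add: Delta_def)
      ultimately show ?thesis using True by auto
    next
      case False
      let ?u = "\<lambda>i. x i / k"
      have "(\<Sum>i\<in>UNIV. ?u i *\<^sub>R rvec (v i)) \<in> Delta v"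
        using x False unfolding D by (auto simp: bary_def sum_divide_distrib[symmetric] intro!: exI[of _ ?u])
      moreover have "rvec m = real k *\<^sub>R (\<Sum>i\<in>UNIV. ?u i *\<^sub>R rvec (v i))"
        using x False by (simp add: bary_def vec_eq_iff rvec_def sum_distrib_left)
      ultimately show ?thesis by blast
    qed
  qed
qed

end

section \<open>The semigroup ring of the cone\<close>

lemma poly_mapping_eq_sum_single:
  fixes g :: "'k \<Rightarrow>\<^sub>0 'r::comm_monoid_add"
  assumes "finite T" "Poly_Mapping.keys g \<subseteq> T"
  shows "g = (\<Sum>k\<in>T. Poly_Mapping.single k (Poly_Mapping.lookup g k))"
proof (rule poly_mapping_eqI)
  fix k
  have "Poly_Mapping.lookup (\<Sum>k\<in>T. Poly_Mapping.single k (Poly_Mapping.lookup g k)) k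
    = (\<Sum>k'\<in>T. if k' = k then Poly_Mapping.lookup g k else 0)"
    by (auto simp: lookup_sum lookup_single when_def intro: sum.cong)
  also have "\<dots> = Poly_Mapping.lookup g k"
    using assms by (auto simp: in_keys_iff)
  finally show "Poly_Mapping.lookup g k = Poly_Mapping.lookup (\<Sum>k\<in>T. Poly_Mapping.single k (Poly_Mapping.lookup g k)) k"
    by simp
qed

lemma cst_mult_single: "cst c * Poly_Mapping.single k b = Poly_Mapping.single k (c * b)"
  by (cases k) (simp add: cst_def mult_single)

lemma cst_add: "cst (a + b) = cst a + cst b"
  by (simp add: cst_def single_add)

lemma cst_mult: "cst (a * b) = cst a * cst b"
  by (simp add: cst_def mult_single)

lemma cst_1: "cst 1 = 1"
  by (simp add: cst_def zero_prod_def[symmetric])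

lemma cst_0: "cst 0 = 0"
  by (simp add: cst_def)

lemma vector_space_LP: "vector_space (\<lambda>c (g :: 'd::finite LP). cst c * g)"
  by unfold_locales (simp_all add: algebra_simps cst_add cst_mult cst_1)

text \<open>All \<open>f x\<close> lie in the span of the monomials with exponents in
  \<open>T\<close>, so this is a dimension count. Independence is asked on every subset of
  \<open>A\<close>, so that injectivity of \<open>f\<close> follows from relations between two
  members.\<close>

lemma card_LP_independent_le:
  fixes f :: "'x \<Rightarrow> 'd::finite LP"
  assumes fin: "finite A" "finite T"
    and keys: "\<And>x. x \<in> A \<Longrightarrow> Poly_Mapping.keys (f x) \<subseteq> T"
    and ind: "\<And>X c. X \<subseteq> A \<Longrightarrow> (\<Sum>x\<in>X. cst (c x) * f x) = 0 \<Longrightarrow> \<forall>x\<in>X. c x = 0"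
  shows "card A \<le> card T"
proof -
  interpret lp: vector_space "\<lambda>c (g :: 'd LP). cst c * g" by (rule vector_space_LP)
  have inj: "inj_on f A"
  proof (rule inj_onI, rule ccontr)
    fix x y assume xy: "x \<in> A" "y \<in> A" "f x = f y" "x \<noteq> y"
    have "(\<Sum>z\<in>{x,y}. cst (if z = x then 1 else - 1) * f z) = (cst 1 + cst (-1)) * f y"
      using xy by (simp add: distrib_right)
    also have "\<dots> = 0" by (simp add: cst_add[symmetric] cst_0)
    finally have "\<forall>z\<in>{x,y}. (if z = x then 1 else - 1) = (0::complex)"
      using ind[of "{x,y}" "\<lambda>z. if z = x then 1 else - 1"] xy by simp
    then show False by auto
  qed
  have "lp.independent (f ` A)"
  proof (rule lp.independent_if_scalars_zero)
    show "finite (f ` A)" using fin by simp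
    fix c g assume "(\<Sum>g\<in>f ` A. cst (c g) * g) = 0" "g \<in> f ` A"
    then show "c g = 0" using ind[of A "\<lambda>x. c (f x)"] inj by (auto simp: sum.reindex)
  qed
  moreover have "f ` A \<subseteq> lp.span ((\<lambda>k. Poly_Mapping.single k 1) ` T)"
  proof
    fix g assume "g \<in> f ` A"
    then have "g = (\<Sum>k\<in>T. cst (Poly_Mapping.lookup g k) * Poly_Mapping.single k 1)"
      using keys fin by (auto simp: cst_mult_single intro!: poly_mapping_eq_sum_single)
    also have "\<dots> \<in> lp.span ((\<lambda>k. Poly_Mapping.single k 1) ` T)"
      by (intro lp.span_sum lp.span_scale lp.span_base) auto
    finally show "g \<in> lp.span ((\<lambda>k. Poly_Mapping.single k 1) ` T)" .
  qed
  ultimately have "card (f ` A) \<le> card ((\<lambda>k. Poly_Mapping.single k (1::complex)) ` T)"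
    using lp.independent_span_bound fin by blast
  also have "\<dots> \<le> card T" using fin by (intro card_image_le)
  finally show ?thesis using inj by (simp add: card_image)
qed

lemma card_int_vec_box:
  fixes B :: nat
  shows "finite {m :: int^'d::finite. \<forall>l. \<bar>m $ l\<bar> \<le> int B}"
    and "card {m :: int^'d. \<forall>l. \<bar>m $ l\<bar> \<le> int B} \<le> (2 * B + 1) ^ CARD('d)"
proof -
  let ?S = "{m :: int^'d. \<forall>l. \<bar>m $ l\<bar> \<le> int B}"
  let ?P = "PiE (UNIV :: 'd set) (\<lambda>_. {- int B..int B})"
  have inj: "inj_on vec_nth ?S" by (auto simp: inj_on_def vec_eq_iff)
  have sub: "vec_nth ` ?S \<subseteq> ?P" by (auto simp: abs_le_iff) (metis minus_le_iff)
  have fin: "finite ?P" by (intro finite_PiE) auto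
  show "finite ?S" using inj sub fin by (meson finite_imageD finite_subset)
  have "card ?S \<le> card ?P" using inj sub fin by (metis card_image card_mono)
  also have "\<dots> = (2 * B + 1) ^ CARD('d)" by (simp add: card_PiE nat_add_distrib nat_mult_distrib)
  finally show "card ?S \<le> (2 * B + 1) ^ CARD('d)" .
qed

lemma theta_eq: "Poly_Mapping.lookup (theta i g) km = of_int (snd km $ i) * Poly_Mapping.lookup g km"
proof -
  have "Poly_Mapping.lookup (theta i g) km =
    (\<Sum>k\<in>Poly_Mapping.keys g. if k = km then of_int (snd km $ i) * Poly_Mapping.lookup g km else 0)"
    by (auto simp: theta_def lookup_sum lookup_single when_def intro: sum.cong)
  also have "\<dots> = of_int (snd km $ i) * Poly_Mapping.lookup g km"
    by (simp add: in_keys_iff)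
  finally show ?thesis .
qed

lemma ideal_gen_take_Suc:
  assumes "m < length Fs" "ideal_gen v (take m Fs) g" "in_S v h"
  shows "ideal_gen v (take (Suc m) Fs) (g + Fs ! m * h)"
proof -
  obtain p where "\<forall>j<m. in_S v (p j)" "g = (\<Sum>j<m. Fs ! j * p j)"
    using assms unfolding ideal_gen_def by auto
  then show ?thesis unfolding ideal_gen_def using assms
    by (intro exI[of _ "p(m := h)"]) (auto simp: less_Suc_eq)
qed

section \<open>Exponents in the cone and the grading\<close>

context split_simplex
begin

definition lattice_cone :: "(nat \<times> (int^'d)) set" where
  "lattice_cone = {(k, m). \<exists>x. (\<forall>i. 0 \<le> x i) \<and> bary x (real k) m}"

lemma in_S_iff: "in_S v g \<longleftrightarrow> Poly_Mapping.keys g \<subseteq> lattice_cone"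
  unfolding in_S_def lattice_cone_def by (simp add: cone_iff) auto

lemma cone_add: "p \<in> lattice_cone \<Longrightarrow> q \<in> lattice_cone \<Longrightarrow> p + q \<in> lattice_cone"
proof -
  assume "p \<in> lattice_cone" "q \<in> lattice_cone"
  then obtain k m x k' m' y where "p = (k, m)" "\<forall>i. 0 \<le> x i" "bary x k m"
      "q = (k', m')" "\<forall>i. 0 \<le> y i" "bary y k' m'"
    by (auto simp: lattice_cone_def)
  then show "p + q \<in> lattice_cone"
    using bary_add[of x k m y k' m'] by (auto simp: lattice_cone_def intro!: exI[of _ "\<lambda>i. x i + y i"])
qed

lemma cone_vertex: "(1, v i) \<in> lattice_cone"
  unfolding lattice_cone_def using bary_vertex[of i]
  by (auto intro!: exI[of _ "\<lambda>j. if j = i then 1 else 0"])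

lemma cone_centre: "(1, 0) \<in> lattice_cone"
  unfolding lattice_cone_def using bary_centre by (auto intro!: exI[of _ "\<lambda>i. w i / W"])

lemma cone_zero: "(0, 0) \<in> lattice_cone"
  unfolding lattice_cone_def by (auto simp: bary_def intro!: exI[of _ "\<lambda>i. 0"])

lemma in_Sk_iff: "in_Sk v k g \<longleftrightarrow> Poly_Mapping.keys g \<subseteq> lattice_cone \<inter> {k} \<times> UNIV"
  unfolding in_Sk_def in_S_iff by auto

lemma in_S_uminus: "in_S v g \<Longrightarrow> in_S v (- g)"
  unfolding in_S_iff by auto

lemma in_S_mult:
  assumes "in_S v g" "in_S v h" shows "in_S v (g * h)"
  unfolding in_S_iff
proof
  fix p assume "p \<in> Poly_Mapping.keys (g * h)"
  then obtain q r where "p = q + r" "q \<in> Poly_Mapping.keys g" "r \<in> Poly_Mapping.keys h"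
    using keys_mult[of g h] by blast
  then show "p \<in> lattice_cone" using assms cone_add unfolding in_S_iff by blast
qed

lemma in_S_sum: "(\<And>x. x \<in> X \<Longrightarrow> in_S v (f x)) \<Longrightarrow> in_S v (\<Sum>x\<in>X. f x)"
  unfolding in_S_iff using keys_sum[of f X] by blast

lemma in_S_one: "in_S v 1"
  unfolding in_S_iff using cone_zero by (simp add: zero_prod_def)

lemma in_S_cst: "in_S v (cst c)"
  unfolding in_S_iff cst_def using cone_zero by simp

lemma in_S_power: "in_S v g \<Longrightarrow> in_S v (g ^ b)"
  by (induction b) (simp_all add: in_S_one in_S_mult)

lemma in_S_prod: "(\<And>x. x \<in> X \<Longrightarrow> in_S v (f x)) \<Longrightarrow> in_S v (\<Prod>x\<in>X. f x)"
  by (induction X rule: infinite_finite_induct) (simp_all add: in_S_one in_S_mult)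

lemma in_Sk_add: "in_Sk v k g \<Longrightarrow> in_Sk v k h \<Longrightarrow> in_Sk v k (g + h)"
  unfolding in_Sk_iff using keys_add[of g h] by blast

lemma in_Sk_sum: "(\<And>x. x \<in> X \<Longrightarrow> in_Sk v k (f x)) \<Longrightarrow> in_Sk v k (\<Sum>x\<in>X. f x)"
  unfolding in_Sk_iff using keys_sum[of f X] by blast

lemma in_Sk_mult:
  assumes "in_Sk v k g" "in_Sk v l h" shows "in_Sk v (k + l) (g * h)"
  unfolding in_Sk_iff
proof
  fix p assume "p \<in> Poly_Mapping.keys (g * h)"
  then obtain q r where qr: "p = q + r" "q \<in> Poly_Mapping.keys g" "r \<in> Poly_Mapping.keys h"
    using keys_mult[of g h] by blast
  then have "q \<in> lattice_cone" "r \<in> lattice_cone" "fst q = k" "fst r = l"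
    using assms unfolding in_Sk_iff by auto
  then show "p \<in> lattice_cone \<inter> {k + l} \<times> UNIV"
    using cone_add[of q r] qr(1) by (cases q; cases r) auto
qed

lemma in_Sk_one: "in_Sk v 0 1"
  unfolding in_Sk_iff using cone_zero by (simp add: zero_prod_def)

lemma in_Sk_power: "in_Sk v 1 g \<Longrightarrow> in_Sk v b (g ^ b)"
proof (induction b)
  case (Suc b)
  then show ?case using in_Sk_mult[of 1 g b "g ^ b"] by simp
qed (simp add: in_Sk_one)

lemma in_Sk_prod: "(\<And>x. x \<in> X \<Longrightarrow> in_Sk v (k x) (f x)) \<Longrightarrow> in_Sk v (\<Sum>x\<in>X. k x) (\<Prod>x\<in>X. f x)"
  by (induction X rule: infinite_finite_induct) (simp_all add: in_Sk_one in_Sk_mult)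

lemma in_Sk_imp_in_S: "in_Sk v k g \<Longrightarrow> in_S v g"
  by (simp add: in_Sk_def)

end

section \<open>Regularity forces nonzero coefficients\<close>

context split_simplex
begin

lemma regular_seq_cancel_power:
  assumes reg: "\<And>g. in_S v g \<Longrightarrow> ideal_gen v Fs (F * g) \<Longrightarrow> ideal_gen v Fs g"
    and F: "in_S v F" and g: "in_S v g" and pw: "ideal_gen v Fs (F ^ r * g)"
  shows "ideal_gen v Fs g"
  using pw
proof (induction r)
  case (Suc r)
  then show ?case using reg[of "F ^ r * g"] F g by (simp add: mult.assoc in_S_mult in_S_power)
qed simp

text \<open>Downward induction on \<open>m\<close>: modulo the first \<open>m\<close> elements of
  the sequence, the monomials in the remaining ones and \<open>e\<close> are independent. The start
  is the assumption that no nonzero polynomial in \<open>e\<close> lies in the full ideal. Exponents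
  are recorded by \<open>p x\<close>, with position \<open>L\<close> reserved for
  \<open>e\<close>.\<close>

lemma regular_seq_monomials_independent:
  fixes Fs :: "'d LP list" and X :: "'x set" and p :: "'x \<Rightarrow> nat \<Rightarrow> nat" and c :: "'x \<Rightarrow> complex"
  defines "L \<equiv> length Fs"
  assumes reg: "\<And>j g. j < L \<Longrightarrow> in_S v g \<Longrightarrow> ideal_gen v (take j Fs) (Fs ! j * g) \<Longrightarrow> ideal_gen v (take j Fs) g"
    and FS: "\<And>j. j < L \<Longrightarrow> in_S v (Fs ! j)" and eS: "in_S v e"
    and e: "\<And>(X :: 'x set) q c. finite X \<Longrightarrow> inj_on q X \<Longrightarrow> ideal_gen v Fs (\<Sum>x\<in>X. cst (c x) * e ^ q x)
              \<Longrightarrow> \<forall>x\<in>X. c x = 0"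
    and "m \<le> L" and fin: "finite X"
    and inj: "\<And>x y. x \<in> X \<Longrightarrow> y \<in> X \<Longrightarrow> (\<And>k. m \<le> k \<Longrightarrow> k \<le> L \<Longrightarrow> p x k = p y k) \<Longrightarrow> x = y"
    and sum: "ideal_gen v (take m Fs) (\<Sum>x\<in>X. cst (c x) * ((\<Prod>k\<in>{m..<L}. Fs ! k ^ p x k) * e ^ p x L))"
  shows "\<forall>x\<in>X. c x = 0"
  using \<open>m \<le> L\<close> fin inj sum
proof (induction m arbitrary: X c rule: inc_induct)
  case base
  have "inj_on (\<lambda>x. p x L) X"
    by (intro inj_onI base.prems(2)) (auto dest: le_antisym)
  then show ?case using e[OF base.prems(1), of "\<lambda>x. p x L" c] base.prems(3) by (simp add: L_def)
next
  case (step m)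
  show ?case
  proof (rule ccontr)
    assume "\<not> (\<forall>x\<in>X. c x = 0)"
    define X1 where "X1 = {x\<in>X. c x \<noteq> 0}"
    have X1: "finite X1" "X1 \<noteq> {}" "X1 \<subseteq> X" using step.prems(1) \<open>\<not> (\<forall>x\<in>X. c x = 0)\<close> by (auto simp: X1_def)
    define M where "M = (\<lambda>x. (\<Prod>k\<in>{Suc m..<L}. Fs ! k ^ p x k) * e ^ p x L)"
    have MS: "in_S v (M x)" for x
      unfolding M_def by (intro in_S_mult in_S_prod in_S_power FS eS) auto
    \<comment> \<open>The least exponent of \<open>Fs ! m\<close> among terms with nonzero
      coefficient; regularity cancels this common power.\<close>
    define r where "r = Min ((\<lambda>x. p x m) ` X1)"
    have r: "r \<le> p x m" if "x \<in> X1" for x using that X1 by (auto simp: r_def)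
    have "r \<in> (\<lambda>x. p x m) ` X1" unfolding r_def using X1 by (intro Min_in) auto
    then obtain x0 where x0: "x0 \<in> X1" "p x0 m = r" by auto
    have FmS: "in_S v (Fs ! m)" using FS step.hyps by simp
    define g where "g = (\<Sum>x\<in>X1. cst (c x) * (Fs ! m ^ (p x m - r) * M x))"
    have gS: "in_S v g" unfolding g_def by (intro in_S_sum in_S_mult in_S_cst in_S_power FmS MS)
    have "(\<Sum>x\<in>X. cst (c x) * ((\<Prod>k\<in>{m..<L}. Fs ! k ^ p x k) * e ^ p x L))
      = (\<Sum>x\<in>X1. cst (c x) * ((\<Prod>k\<in>{m..<L}. Fs ! k ^ p x k) * e ^ p x L))"
      using step.prems(1) by (intro sum.mono_neutral_right) (auto simp: X1_def cst_0)
    also have "\<dots> = Fs ! m ^ r * g"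
      unfolding g_def sum_distrib_left
    proof (rule sum.cong[OF refl])
      fix x assume "x \<in> X1"
      have "(\<Prod>k\<in>{m..<L}. Fs ! k ^ p x k) = Fs ! m ^ p x m * (\<Prod>k\<in>{Suc m..<L}. Fs ! k ^ p x k)"
        using step.hyps by (simp add: prod.atLeast_Suc_lessThan)
      moreover have "Fs ! m ^ p x m = Fs ! m ^ r * Fs ! m ^ (p x m - r)"
        using r[OF \<open>x \<in> X1\<close>] by (simp flip: power_add)
      ultimately show "cst (c x) * ((\<Prod>k\<in>{m..<L}. Fs ! k ^ p x k) * e ^ p x L)
          = Fs ! m ^ r * (cst (c x) * (Fs ! m ^ (p x m - r) * M x))"
        by (simp add: M_def mult_ac)
    qed
    finally have "ideal_gen v (take m Fs) (Fs ! m ^ r * g)" using step.prems(3) by simp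
    from regular_seq_cancel_power[OF reg[OF step.hyps(2)] FmS gS this]
    have gI: "ideal_gen v (take m Fs) g" .
    define X0 where "X0 = {x\<in>X1. p x m = r}"
    define h where "h = (\<Sum>x\<in>X1 - X0. cst (c x) * (Fs ! m ^ (p x m - r - 1) * M x))"
    have hS: "in_S v h" unfolding h_def by (intro in_S_sum in_S_mult in_S_cst in_S_power FmS MS)
    have "g = (\<Sum>x\<in>X1 - X0. cst (c x) * (Fs ! m ^ (p x m - r) * M x)) + (\<Sum>x\<in>X0. cst (c x) * (Fs ! m ^ (p x m - r) * M x))"
      unfolding g_def using X1 by (intro sum.subset_diff) (auto simp: X0_def)
    also have "(\<Sum>x\<in>X0. cst (c x) * (Fs ! m ^ (p x m - r) * M x)) = (\<Sum>x\<in>X0. cst (c x) * M x)"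
      by (intro sum.cong) (auto simp: X0_def)
    also have "(\<Sum>x\<in>X1 - X0. cst (c x) * (Fs ! m ^ (p x m - r) * M x)) = Fs ! m * h"
      unfolding h_def sum_distrib_left
    proof (rule sum.cong[OF refl])
      fix x assume "x \<in> X1 - X0"
      then have "p x m - r = Suc (p x m - r - 1)" using r by (force simp: X0_def)
      then have "Fs ! m ^ (p x m - r) = Fs ! m * Fs ! m ^ (p x m - r - 1)" by (metis power_Suc)
      then show "cst (c x) * (Fs ! m ^ (p x m - r) * M x) = Fs ! m * (cst (c x) * (Fs ! m ^ (p x m - r - 1) * M x))"
        by (simp add: mult_ac)
    qed
    \<comment> \<open>Terms of larger exponent are multiples of \<open>Fs ! m\<close>. Modulo one
      more generator only those of least exponent survive, and they include a nonzero
      coefficient.\<close>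
    finally have eq: "(\<Sum>x\<in>X0. cst (c x) * M x) = g + Fs ! m * (- h)" by simp
    have "ideal_gen v (take (Suc m) Fs) (\<Sum>x\<in>X0. cst (c x) * M x)"
      unfolding eq using step.hyps gI hS by (intro ideal_gen_take_Suc in_S_uminus) (auto simp: L_def)
    then have "\<forall>x\<in>X0. c x = 0"
    proof (intro step.IH)
      fix x y assume xy: "x \<in> X0" "y \<in> X0" and k: "\<And>k. Suc m \<le> k \<Longrightarrow> k \<le> L \<Longrightarrow> p x k = p y k"
      show "x = y"
      proof (rule step.prems(2))
        fix k assume "m \<le> k" "k \<le> L"
        then show "p x k = p y k" using k[of k] xy by (cases "k = m") (auto simp: X0_def)
      qed (use xy X1 in \<open>auto simp: X0_def\<close>)
    qed (use X1 in \<open>auto simp: X0_def M_def\<close>)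
    then show False using x0 by (auto simp: X0_def X1_def)
  qed
qed

text \<open>A point of degree \<open>k\<close> is a nonnegative combination of vertices of total
  weight \<open>k\<close>, so its entries are bounded by \<open>k * V\<close> and the points can be
  counted in a box.\<close>

lemma card_cone_le:
  fixes N :: nat
  assumes V: "\<And>i l. \<bar>v i $ l\<bar> \<le> int V"
  shows "finite (lattice_cone \<inter> {..N} \<times> UNIV)"
    and "card (lattice_cone \<inter> {..N} \<times> UNIV) \<le> (N + 1) * (2 * (N * V) + 1) ^ CARD('d)"
proof -
  let ?B = "{m :: int^'d. \<forall>l. \<bar>m $ l\<bar> \<le> int (N * V)}"
  have sub: "lattice_cone \<inter> {..N} \<times> UNIV \<subseteq> {..N} \<times> ?B"
  proof
    fix p assume "p \<in> lattice_cone \<inter> {..N} \<times> UNIV"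
    then obtain k m where p: "p = (k, m)" "(k, m) \<in> lattice_cone" and k: "k \<in> {..N}" by auto
    then obtain x where x: "\<forall>i. 0 \<le> x i" "bary x (real k) m" by (auto simp: lattice_cone_def)
    have "\<bar>m $ l\<bar> \<le> int (N * V)" for l
    proof -
      have "\<bar>real_of_int (m $ l)\<bar> = \<bar>\<Sum>i\<in>UNIV. x i * of_int (v i $ l)\<bar>" using x by (simp add: bary_def)
      also have "\<dots> \<le> (\<Sum>i\<in>UNIV. \<bar>x i * of_int (v i $ l)\<bar>)" by (rule sum_abs)
      also have "\<dots> \<le> (\<Sum>i\<in>UNIV. x i * V)"
      proof (rule sum_mono)
        fix i
        have "\<bar>real_of_int (v i $ l)\<bar> \<le> real V" using V[of i l] by linarith
        then show "\<bar>x i * of_int (v i $ l)\<bar> \<le> x i * V" using x by (simp add: abs_mult mult_left_mono)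
      qed
      also have "\<dots> = real k * V" using x by (simp add: bary_def sum_distrib_right[symmetric])
      also have "\<dots> \<le> real N * V" using k by (intro mult_right_mono) auto
      finally have "\<bar>real_of_int (m $ l)\<bar> \<le> real_of_int (int (N * V))" by simp
      then show ?thesis by linarith
    qed
    then show "p \<in> {..N} \<times> ?B" using k p by simp
  qed
  have fin: "finite ({..N} \<times> ?B)" using card_int_vec_box(1)[of "N * V"] by (intro finite_cartesian_product) auto
  show "finite (lattice_cone \<inter> {..N} \<times> UNIV)" using sub fin by (rule finite_subset)
  have "card (lattice_cone \<inter> {..N} \<times> UNIV) \<le> card ({..N} \<times> ?B)" using fin sub by (rule card_mono)
  also have "\<dots> = (N + 1) * card ?B" by (simp add: card_cartesian_product)
  also have "\<dots> \<le> (N + 1) * (2 * (N * V) + 1) ^ CARD('d)"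
    using card_int_vec_box(2)[of "N * V", where 'd='d] by (intro mult_left_mono) auto
  finally show "card (lattice_cone \<inter> {..N} \<times> UNIV) \<le> (N + 1) * (2 * (N * V) + 1) ^ CARD('d)" .
qed

text \<open>Here the \<open>d + 2\<close> elements \<open>Fs\<close>, \<open>e\<close> of degree one would be algebraically independent,
  although the Hilbert function of the semigroup ring only grows like a polynomial of degree \<open>d\<close>.\<close>

lemma regular_seq_no_transcendental:
  assumes len: "length Fs = CARD('d) + 1"
    and reg: "\<And>j g. j < length Fs \<Longrightarrow> in_S v g \<Longrightarrow> ideal_gen v (take j Fs) (Fs ! j * g) \<Longrightarrow> ideal_gen v (take j Fs) g"
    and FS: "\<And>j. j < length Fs \<Longrightarrow> in_Sk v 1 (Fs ! j)" and eS: "in_Sk v 1 e"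
    and e: "\<And>(X :: (nat \<Rightarrow> nat) set) q c. finite X \<Longrightarrow> inj_on q X \<Longrightarrow> ideal_gen v Fs (\<Sum>x\<in>X. cst (c x) * e ^ q x)
              \<Longrightarrow> \<forall>x\<in>X. c x = 0"
  shows False
proof -
  define L where "L = CARD('d) + 1"
  \<comment> \<open>The added \<open>1\<close> makes \<open>V\<close> positive, so that the factor
    \<open>N + 1\<close> below is absorbed into \<open>2 * (N * V) + 1\<close>.\<close>
  define V where "V = nat (Max (range (\<lambda>(i, l). \<bar>v i $ l\<bar>))) + 1"
  have V: "\<bar>v i $ l\<bar> \<le> int V" for i l
  proof -
    have "\<bar>v i $ l\<bar> \<le> Max (range (\<lambda>(i, l). \<bar>v i $ l\<bar>))"
      by (rule Max_ge) (auto intro: range_eqI[of _ _ "(i, l)"])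
    then show ?thesis unfolding V_def using abs_ge_zero[of "v i $ l"] by linarith
  qed
  \<comment> \<open>\<open>A\<close> has \<open>K ^ (L + 1)\<close> exponent tuples, of degree at
    most \<open>N\<close>, against at most \<open>(B * K) ^ L\<close> lattice points. Hence
    \<open>K\<close> is chosen larger than \<open>B ^ L\<close>.\<close>
  define B where "B = 2 * (L + 1) * V + 1"
  define K where "K = B ^ L + 1"
  define N where "N = (L + 1) * K"
  define A where "A = PiE {..L} (\<lambda>_. {..<K})"
  define f where "f = (\<lambda>p :: nat \<Rightarrow> nat. (\<Prod>k\<in>{0..<L}. Fs ! k ^ p k) * e ^ p L)"
  have "card A \<le> card (lattice_cone \<inter> {..N} \<times> UNIV)"
  proof (rule card_LP_independent_le[of _ _ f])
    show "finite A" by (auto simp: A_def intro: finite_PiE)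
    show "finite (lattice_cone \<inter> {..N} \<times> UNIV)" using card_cone_le(1)[OF V] .
    show "Poly_Mapping.keys (f p) \<subseteq> lattice_cone \<inter> {..N} \<times> UNIV" if "p \<in> A" for p
    proof -
      have "in_Sk v ((\<Sum>k\<in>{0..<L}. p k) + p L) (f p)"
        unfolding f_def by (intro in_Sk_mult in_Sk_prod in_Sk_power FS eS) (auto simp: len L_def)
      moreover have "(\<Sum>k\<in>{0..<L}. p k) + p L \<le> N"
      proof -
        have "(\<Sum>k\<in>{0..<L}. p k) + p L = (\<Sum>k\<in>{..L}. p k)"
          by (simp add: atLeast0LessThan lessThan_Suc_atMost[symmetric])
        also have "\<dots> \<le> (\<Sum>k\<in>{..L}. K)"
          using that by (intro sum_mono) (auto simp: A_def PiE_def Pi_def less_imp_le)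
        finally show ?thesis by (simp add: N_def)
      qed
      ultimately show ?thesis unfolding in_Sk_iff by auto
    qed
    show "\<forall>p\<in>X. c p = 0" if X: "X \<subseteq> A" and s: "(\<Sum>p\<in>X. cst (c p) * f p) = 0" for X c
    proof (rule regular_seq_monomials_independent[where Fs = Fs and m = 0 and p = "\<lambda>p. p" and e = e])
      show "finite X" using X \<open>finite A\<close> by (rule finite_subset)
      show "ideal_gen v (take 0 Fs) (\<Sum>x\<in>X. cst (c x) * ((\<Prod>k = 0..<length Fs. Fs ! k ^ x k) * e ^ x (length Fs)))"
        using s by (simp add: ideal_gen_def f_def len L_def)
      show "x = y" if "x \<in> X" "y \<in> X" "\<And>k. 0 \<le> k \<Longrightarrow> k \<le> length Fs \<Longrightarrow> x k = y k" for x y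
        using that X unfolding A_def by (intro PiE_ext[of x "{..L}" "\<lambda>_. {..<K}" y]) (auto simp: len L_def)
    qed (use reg FS eS e in \<open>auto intro: in_Sk_imp_in_S\<close>)
  qed
  also have "\<dots> \<le> (N + 1) * (2 * (N * V) + 1) ^ CARD('d)" using card_cone_le(2)[OF V] .
  also have "\<dots> \<le> (2 * (N * V) + 1) ^ L"
  proof -
    have "N \<le> N * V" by (simp add: V_def)
    then show ?thesis unfolding L_def by simp
  qed
  also have "\<dots> \<le> (B * K) ^ L"
  proof (rule power_mono)
    have "B * K = 2 * (N * V) + K" by (simp add: B_def N_def algebra_simps)
    then show "2 * (N * V) + 1 \<le> B * K" by (simp add: K_def)
  qed simp
  also have "\<dots> = B ^ L * K ^ L" by (simp add: power_mult_distrib)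
  also have "\<dots> < K * K ^ L" by (simp add: K_def)
  also have "\<dots> = card A" by (simp add: A_def card_PiE)
  finally show False by simp
qed

section \<open>Supports of the generators and the rays of the cone\<close>

lemma keys_F0: "Poly_Mapping.keys (F0 v a) \<subseteq> insert (1, 0) {(1, v j) |j. a j \<noteq> 0}"
proof -
  have "F0 v a = Poly_Mapping.single (1, 0) 1 - (\<Sum>j\<in>UNIV. Poly_Mapping.single (1, v j) (a j))"
    by (simp add: F0_def fpoly_def mon_def right_diff_distrib sum_distrib_left mult_single)
  then have "Poly_Mapping.keys (F0 v a) \<subseteq> Poly_Mapping.keys (Poly_Mapping.single (1, 0 :: int^'d) (1::complex))
      \<union> (\<Union>j. Poly_Mapping.keys (Poly_Mapping.single (1, v j) (a j)))"
    using keys_diff[of "Poly_Mapping.single (1::nat, 0 :: int^'d) (1::complex)" "\<Sum>j\<in>UNIV. Poly_Mapping.single (1, v j) (a j)"]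
      keys_sum[of "\<lambda>j. Poly_Mapping.single (1::nat, v j) (a j)" UNIV] by auto
  then show ?thesis by (auto split: if_splits)
qed

lemma theta_fpoly: "theta l (fpoly v a) = - (\<Sum>j\<in>UNIV. Poly_Mapping.single (0, v j) (of_int (v j $ l) * a j))"
proof (rule poly_mapping_eqI)
  fix km :: "nat \<times> (int^'d)"
  have 1: "of_int (snd km $ l) * ((1::complex) when (0, 0) = km) = 0"
    by (cases km) (simp add: when_def)
  have 2: "of_int (snd km $ l) * (a j when (0, v j) = km) = (of_int (v j $ l) * a j when (0, v j) = km)" for j
    by (cases km) (simp add: when_def)
  show "Poly_Mapping.lookup (theta l (fpoly v a)) km =
      Poly_Mapping.lookup (- (\<Sum>j\<in>UNIV. Poly_Mapping.single (0, v j) (of_int (v j $ l) * a j))) km"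
    by (simp add: theta_eq fpoly_def mon_def lookup_minus lookup_sum lookup_single sum_distrib_left
        right_diff_distrib 1 2)
qed

lemma keys_Fi: "Poly_Mapping.keys (Fi v a l) \<subseteq> {(1, v j) |j. a j \<noteq> 0}"
proof -
  have "Fi v a l = - (\<Sum>j\<in>UNIV. Poly_Mapping.single (1, v j) (of_int (v j $ l) * a j))"
    by (simp add: Fi_def theta_fpoly mon_def sum_distrib_left mult_single)
  then have "Poly_Mapping.keys (Fi v a l) \<subseteq> (\<Union>j. Poly_Mapping.keys (Poly_Mapping.single (1, v j) (of_int (v j $ l) * a j)))"
    using keys_sum[of "\<lambda>j. Poly_Mapping.single (1::nat, v j) (of_int (v j $ l) * a j)" UNIV] by simp
  then show ?thesis by (auto split: if_splits)
qed

text \<open>The ray through \<open>(1, v i)\<close> is a face of the cone: a sum of two exponents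
  lies on it only if both do. With \<open>a i = 0\<close> the support of \<open>F\<close> contains
  only the centre, whose coordinates are all positive, and vertices other than
  \<open>v i\<close>.\<close>

lemma ideal_avoids_ray:
  assumes a: "a i = 0" and h: "in_S v h" and F: "Poly_Mapping.keys F \<subseteq> insert (1, 0) {(1, v j) |j. a j \<noteq> 0}"
  shows "Poly_Mapping.lookup (F * h) (b, of_nat b *s v i) = 0"
proof (rule ccontr)
  assume "\<not> ?thesis"
  then have "(b, of_nat b *s v i) \<in> Poly_Mapping.keys (F * h)" by (simp add: in_keys_iff)
  then obtain q r where qr: "(b, of_nat b *s v i) = q + r" "q \<in> Poly_Mapping.keys F" "r \<in> Poly_Mapping.keys h"
    using keys_mult[of F h] by blast
  obtain k m where r: "r = (k, m)" by (cases r)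
  have "r \<in> lattice_cone" using qr h unfolding in_S_iff by blast
  then obtain x where x: "\<forall>i. 0 \<le> x i" "bary x (real k) m" by (auto simp: lattice_cone_def r)
  have ray: "bary (\<lambda>j. if j = i then real b else 0) b (of_nat b *s v i)"
    by (simp add: bary_def if_distrib[of "\<lambda>x. x * _"] cong: if_cong)
  \<comment> \<open>A second vertex exists because \<open>n = d + 1\<close> is at least two; its
    coordinate is positive at the centre and zero on the ray.\<close>
  obtain j where j: "j \<noteq> i"
  proof -
    have "card {i} < CARD('n)" using card by simp
    then show ?thesis using that by (metis UNIV_eq_I card_mono finite insertI1 linorder_not_less singleton_iff subsetI)
  qed
  consider "q = (1, 0)" | j where "q = (1, v j)" "j \<noteq> i" using qr(2) F a by auto
  then show False
  proof cases
    case 1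
    have "bary (\<lambda>i. w i / W + x i) (1 + real k) (0 + m)" using bary_add[OF bary_centre x(2)] .
    moreover have "1 + real k = b" "0 + m = of_nat b *s v i" using qr(1) r 1 by auto
    ultimately have "(\<lambda>i. w i / W + x i) = (\<lambda>j. if j = i then real b else 0)"
      using ray by (metis bary_unique)
    then have "w j / W + x j = 0" using j by (metis (mono_tags, lifting))
    moreover have "real (w j) / W > 0" using wpos W_pos by simp
    ultimately show False using x(1) by (metis add_pos_nonneg less_irrefl)
  next
    case (2 j)
    have "bary (\<lambda>l. (if l = j then 1 else 0) + x l) (1 + real k) (v j + m)" using bary_add[OF bary_vertex x(2)] .
    moreover have "1 + real k = b" "v j + m = of_nat b *s v i" using qr(1) r 2 by auto
    ultimately have "(\<lambda>l. (if l = j then 1 else 0) + x l) = (\<lambda>j. if j = i then real b else 0)"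
      using ray by (metis bary_unique)
    then have "1 + x j = 0" using 2 by (metis (mono_tags, lifting))
    then show False using x(1) by (metis add_pos_nonneg less_irrefl zero_less_one)
  qed
qed

text \<open>If \<open>a i = 0\<close>, elements of the ideal have no coefficients on the ray of
  \<open>v i\<close>, whereas the powers of \<open>e\<close> are distinct points of that ray. So no
  nonzero polynomial in \<open>e\<close> lies in the ideal, which
  \<open>regular_seq_no_transcendental\<close> excludes.\<close>

lemma Delta_regular_nonzero:
  assumes "Delta_regular v a" shows "a i \<noteq> 0"
proof
  assume a: "a i = 0"
  obtain xs where xs: "distinct xs" "set xs = (UNIV :: 'd set)" "regular_seq v (F0 v a # map (Fi v a) xs)"
    using assms by (auto simp: Delta_regular_def)
  define Fs where "Fs = F0 v a # map (Fi v a) xs"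
  define e :: "'d LP" where "e = Poly_Mapping.single (1, v i) 1"
  have len: "length Fs = CARD('d) + 1"
    using xs distinct_card[of xs] by (simp add: Fs_def)
  have keys: "Poly_Mapping.keys (Fs ! j) \<subseteq> insert (1, 0) {(1, v j) |j. a j \<noteq> 0}" if "j < length Fs" for j
    using that keys_F0[of a] keys_Fi[of a] by (cases j) (auto simp: Fs_def)
  show False
  proof (rule regular_seq_no_transcendental[OF len])
    show "ideal_gen v (take j Fs) g" if "j < length Fs" "in_S v g" "ideal_gen v (take j Fs) (Fs ! j * g)" for j g
      using xs(3) that unfolding Fs_def[symmetric] regular_seq_def by blast
    show "in_Sk v 1 (Fs ! j)" if "j < length Fs" for j
      unfolding in_Sk_iff using keys[OF that] cone_vertex cone_centre by auto
    show "in_Sk v 1 e" unfolding in_Sk_iff e_def using cone_vertex by simp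
    fix X :: "(nat \<Rightarrow> nat) set" and q c
    assume fin: "finite X" and inj: "inj_on q X" and id: "ideal_gen v Fs (\<Sum>x\<in>X. cst (c x) * e ^ q x)"
    have pw: "e ^ b = Poly_Mapping.single (b, of_nat b *s v i) 1" for b
    proof (induction b)
      case 0
      show ?case by (simp add: zero_prod_def[symmetric] flip: single_one)
    next
      case (Suc b)
      then show ?case by (simp add: e_def mult_single vec_eq_iff distrib_right)
    qed
    show "\<forall>x\<in>X. c x = 0"
    proof
      fix x assume "x \<in> X"
      obtain h where h: "\<forall>j<length Fs. in_S v (h j)"
        "(\<Sum>x\<in>X. cst (c x) * e ^ q x) = (\<Sum>j<length Fs. Fs ! j * h j)"
        using id unfolding ideal_gen_def by auto
      \<comment> \<open>Coefficients are compared at the ray point of degree \<open>q x\<close>: the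
        ideal side gives zero, and injectivity of \<open>q\<close> isolates \<open>c x\<close> on
        the other side.\<close>
      have "Poly_Mapping.lookup (\<Sum>x\<in>X. cst (c x) * e ^ q x) (q x, of_nat (q x) *s v i) = 0"
        unfolding h(2) lookup_sum using h(1) keys a
        by (intro sum.neutral ballI ideal_avoids_ray[where a = a]) auto
      moreover have "Poly_Mapping.lookup (\<Sum>x\<in>X. cst (c x) * e ^ q x) (q x, of_nat (q x) *s v i)
          = (\<Sum>y\<in>X. if y = x then c y else 0)"
        unfolding lookup_sum pw cst_mult_single lookup_single
        using inj \<open>x \<in> X\<close> by (intro sum.cong) (auto simp: when_def dest: inj_onD)
      ultimately show "c x = 0" using fin \<open>x \<in> X\<close> by simp
    qed
  qed
qed

end

section \<open>The residue functional\<close>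

context split_simplex
begin

text \<open>Here \<open>t\<close> is the degree not accounted for by \<open>rep\<close>. Its
  remainder modulo \<open>W\<close> is the number of copies of the centre, and its quotient is the
  multiple of \<open>w\<close> to be added to \<open>rep\<close>. The coordinates may be negative,
  hence the integer powers.\<close>

definition phi :: "('n \<Rightarrow> complex) \<Rightarrow> nat \<times> (int^'d) \<Rightarrow> complex" where
  "phi a p = (let t = int (fst p) - (\<Sum>i\<in>UNIV. rep (snd p) i) in
     of_nat W ^ nat (t mod int W) *
     (\<Prod>i\<in>UNIV. (of_nat (w i) / a i) powi (rep (snd p) i + (t div int W) * int (w i))))"

text \<open>Integer coordinates, of any sign, of \<open>(k, m)\<close> in terms of the
  \<open>(1, v i)\<close> together with \<open>j\<close> copies of the centre
  \<open>(1, 0)\<close>.\<close>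

definition is_rep :: "('n \<Rightarrow> int) \<Rightarrow> nat \<Rightarrow> int^'d \<Rightarrow> nat \<Rightarrow> bool" where
  "is_rep c k m j \<longleftrightarrow> (\<forall>l. (\<Sum>i\<in>UNIV. c i * v i $ l) = m $ l) \<and> (\<Sum>i\<in>UNIV. c i) + int j = int k"

text \<open>Adding \<open>w\<close> to the coefficients fixes \<open>m\<close> and raises the total
  by \<open>W\<close>, so division with remainder brings \<open>j\<close> below
  \<open>W\<close>.\<close>

lemma is_rep_exists: obtains c j where "is_rep c k m j" "j < W"
proof -
  define t where "t = int k - (\<Sum>i\<in>UNIV. rep m i)"
  define c where "c = (\<lambda>i. rep m i + (t div int W) * int (w i))"
  have "(\<Sum>i\<in>UNIV. c i * v i $ l) = m $ l" for l
  proof -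
    have "(\<Sum>i\<in>UNIV. c i * v i $ l) = m $ l + (t div int W) * (\<Sum>i\<in>UNIV. int (w i) * v i $ l)"
      by (simp add: c_def distrib_right sum.distrib rep sum_distrib_left mult.assoc)
    then show ?thesis by (simp add: relation)
  qed
  moreover have "(\<Sum>i\<in>UNIV. c i) = int k - t mod int W"
  proof -
    have "(\<Sum>i\<in>UNIV. c i) = (\<Sum>i\<in>UNIV. rep m i) + (t div int W) * int W"
      by (simp add: c_def sum.distrib sum_distrib_left W_def)
    then show ?thesis by (simp add: t_def minus_mod_eq_div_mult[symmetric])
  qed
  ultimately have "is_rep c k m (nat (t mod int W))" using W_pos by (simp add: is_rep_def)
  moreover have "nat (t mod int W) < W" using W_pos by (simp add: nat_less_iff)
  ultimately show ?thesis using that by blast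
qed

text \<open>Any coefficients of \<open>m\<close> differ from \<open>rep m\<close> by
  \<open>q\<close> times \<open>w\<close>; the bound \<open>j < W\<close> then identifies
  \<open>q\<close> and \<open>j\<close> as the quotient and remainder in \<open>phi\<close>. All
  later values are computed from a convenient representation.\<close>

lemma phi_eq:
  assumes "is_rep c k m j" "j < W"
  shows "phi a (k, m) = of_nat W ^ j * (\<Prod>i\<in>UNIV. (of_nat (w i) / a i) powi c i)"
proof -
  define q where "q = (\<Sum>i\<in>UNIV. (c i - rep m i) * s i)"
  have "c i - rep m i = q * int (w i)" for i
    using kernel[of "\<lambda>i. c i - rep m i" i] assms
    by (simp add: q_def is_rep_def left_diff_distrib sum_subtractf rep)
  then have c: "c i = rep m i + q * int (w i)" for i by (metis add.commute diff_add_cancel)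
  have "(\<Sum>i\<in>UNIV. c i) = (\<Sum>i\<in>UNIV. rep m i) + q * int W"
    by (simp add: c sum.distrib sum_distrib_left W_def)
  then have t: "int k - (\<Sum>i\<in>UNIV. rep m i) = int j + q * int W"
    using assms by (simp add: is_rep_def)
  show ?thesis using assms(2) by (simp add: phi_def Let_def t c)
qed

lemma is_rep_vertex: "is_rep c k m j \<Longrightarrow> is_rep (\<lambda>l. c l + (if l = i then 1 else 0)) (k + 1) (m + v i) j"
  by (simp add: is_rep_def distrib_right sum.distrib if_distrib[of "\<lambda>x. x * _"] cong: if_cong)

lemma is_rep_vertex': "is_rep c (k + 1) m j \<Longrightarrow> is_rep (\<lambda>l. c l - (if l = i then 1 else 0)) k (m - v i) j"
  by (simp add: is_rep_def left_diff_distrib sum_subtractf if_distrib[of "\<lambda>x. x * _"] cong: if_cong)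

lemma is_rep_centre: "is_rep c k m j \<Longrightarrow> is_rep c (k + 1) m (j + 1)"
  by (simp add: is_rep_def)

text \<open>Each of the \<open>j\<close> copies of the centre contributes the coordinates
  \<open>w i / W\<close>.\<close>

lemma bary_of_rep: "is_rep c k m j \<Longrightarrow> bary (\<lambda>i. of_int (c i) + j * (w i / W)) k m"
proof -
  assume c: "is_rep c k m j"
  have "(\<Sum>i\<in>UNIV. (of_int (c i) + j * (w i / W)) * of_int (v i $ l)) = of_int (m $ l)" for l
  proof -
    have "(\<Sum>i\<in>UNIV. (of_int (c i) + j * (w i / W)) * of_int (v i $ l)) =
      real_of_int (\<Sum>i\<in>UNIV. c i * v i $ l) + j * (\<Sum>i\<in>UNIV. (w i / W) * of_int (v i $ l))"
      by (simp add: distrib_right sum.distrib sum_distrib_left mult.assoc)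
    moreover have "(\<Sum>i\<in>UNIV. c i * v i $ l) = m $ l" using c by (simp add: is_rep_def)
    moreover have "(\<Sum>i\<in>UNIV. (w i / W) * of_int (v i $ l)) = 0" using bary_centre by (simp add: bary_def)
    ultimately show ?thesis by (simp only: mult_zero_right add_0_right)
  qed
  moreover have "(\<Sum>i\<in>UNIV. of_int (c i) + j * (w i / W)) = real k"
  proof -
    have "(\<Sum>i\<in>UNIV. of_int (c i) + j * (w i / W)) = real_of_int (\<Sum>i\<in>UNIV. c i) + j * (\<Sum>i\<in>UNIV. w i / W)"
      by (simp add: sum.distrib sum_distrib_left)
    also have "(\<Sum>i\<in>UNIV. w i / W) = 1" using bary_centre by (simp add: bary_def)
    finally have "(\<Sum>i\<in>UNIV. of_int (c i) + j * (w i / W)) = real_of_int ((\<Sum>i\<in>UNIV. c i) + int j)" by simp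
    also have "\<dots> = real_of_int (int k)" using c by (simp only: is_rep_def)
    finally show ?thesis by simp
  qed
  ultimately show ?thesis by (simp add: bary_def)
qed

lemma rep_nonneg:
  assumes "(k, m) \<in> lattice_cone" "is_rep c k m j"
  shows "0 \<le> of_int (c i) + j * (w i / W)"
proof -
  obtain x where x: "\<forall>i. 0 \<le> x i" "bary x (real k) m" using assms(1) by (auto simp: lattice_cone_def)
  have "x = (\<lambda>i. of_int (c i) + j * (w i / W))" by (rule bary_unique[OF x(2) bary_of_rep[OF assms(2)]])
  with x(1) show ?thesis by metis
qed

text \<open>In the last class \<open>j = W - 1\<close> every barycentric coordinate is at least \<open>1 - w i / W\<close>.\<close>

lemma rep_not_last_class:
  assumes cone: "(k, m) \<in> lattice_cone" and c: "is_rep c k m j" and "j < W" and k: "k < CARD('d)"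
  shows "j + 1 < W"
proof (rule ccontr)
  assume "\<not> j + 1 < W"
  with \<open>j < W\<close> have j: "real j = W - 1" by linarith
  let ?x = "\<lambda>i. of_int (c i) + j * (w i / W)"
  have "1 - w i / W \<le> ?x i" for i
  proof -
    have x: "?x i = of_int (c i + int (w i)) - w i / W"
      using W_pos by (simp add: j field_simps)
    have "0 < w i / W" using wpos W_pos by simp
    then have "0 < real_of_int (c i + int (w i))" using rep_nonneg[OF cone c, of i] x by linarith
    then have "1 \<le> c i + int (w i)" by linarith
    then have "1 \<le> real_of_int (c i + int (w i))" by linarith
    then show ?thesis unfolding x by simp
  qed
  then have "(\<Sum>i\<in>UNIV. 1 - w i / W) \<le> (\<Sum>i\<in>UNIV. ?x i)" by (rule sum_mono)
  also have "(\<Sum>i\<in>UNIV. ?x i) = k" using bary_of_rep[OF c] by (simp add: bary_def)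
  also have "(\<Sum>i\<in>UNIV. 1 - w i / W) = real CARD('n) - 1"
    using bary_centre by (simp add: sum_subtractf bary_def)
  finally show False using k card by simp
qed

section \<open>Linear extension of the functional to Laurent polynomials\<close>

definition Phi :: "('n \<Rightarrow> complex) \<Rightarrow> 'd LP \<Rightarrow> complex" where
  "Phi a g = (\<Sum>p\<in>Poly_Mapping.keys g. Poly_Mapping.lookup g p * phi a p)"

lemma Phi_superset:
  assumes "finite T" "Poly_Mapping.keys g \<subseteq> T"
  shows "Phi a g = (\<Sum>p\<in>T. Poly_Mapping.lookup g p * phi a p)"
  unfolding Phi_def using assms by (intro sum.mono_neutral_left) (auto simp: in_keys_iff)

lemma Phi_add: "Phi a (g + h) = Phi a g + Phi a h"
proof -
  let ?T = "Poly_Mapping.keys g \<union> Poly_Mapping.keys h"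
  have "Poly_Mapping.keys (g + h) \<subseteq> ?T" by (rule keys_add)
  then show ?thesis
    by (simp add: Phi_superset[of ?T] lookup_add distrib_right sum.distrib)
qed

lemma Phi_single: "Phi a (Poly_Mapping.single p b) = b * phi a p"
  by (subst Phi_superset[of "{p}"]) auto

lemma Phi_zero: "Phi a 0 = 0"
  by (simp add: Phi_def)

lemma Phi_uminus: "Phi a (- g) = - Phi a g"
  using Phi_add[of a g "- g"] by (simp add: Phi_zero eq_neg_iff_add_eq_0 add.commute)

lemma Phi_diff: "Phi a (g - h) = Phi a g - Phi a h"
  using Phi_add[of a g "- h"] by (simp add: Phi_uminus)

lemma Phi_sum: "Phi a (\<Sum>x\<in>X. f x) = (\<Sum>x\<in>X. Phi a (f x))"
  by (induction X rule: infinite_finite_induct) (simp_all add: Phi_zero Phi_add)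

lemma Phi_cst: "Phi a (cst c * g) = c * Phi a g"
proof -
  have "cst c * g = cst c * (\<Sum>p\<in>Poly_Mapping.keys g. Poly_Mapping.single p (Poly_Mapping.lookup g p))"
    by (rule arg_cong[OF poly_mapping_eq_sum_single]) auto
  then show ?thesis
    by (simp add: sum_distrib_left cst_mult_single Phi_sum Phi_single) (simp add: Phi_def sum_distrib_left mult.assoc)
qed

lemma F0_mult_single:
  "F0 v a * Poly_Mapping.single (k, m) b = Poly_Mapping.single (k + 1, m) b
    - (\<Sum>j\<in>UNIV. Poly_Mapping.single (k + 1, m + v j) (a j * b))"
  by (simp add: F0_def fpoly_def mon_def right_diff_distrib left_diff_distrib sum_distrib_left sum_distrib_right
      mult_single add.commute)

lemma Fi_mult_single:
  "Fi v a l * Poly_Mapping.single (k, m) b =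
    - (\<Sum>j\<in>UNIV. Poly_Mapping.single (k + 1, m + v j) (of_int (v j $ l) * a j * b))"
  by (simp add: Fi_def theta_fpoly mon_def sum_distrib_left sum_distrib_right mult_single add.commute)

section \<open>Annihilation of the ideal and uniqueness of the residue\<close>

context
  fixes a :: "'n \<Rightarrow> complex"
  assumes a: "\<And>i. a i \<noteq> 0"
begin

lemma phi_vertex: "phi a (k + 1, m + v i) = of_nat (w i) / a i * phi a (k, m)"
proof -
  obtain c j where c: "is_rep c k m j" "j < W" by (rule is_rep_exists)
  have nz: "of_nat (w l) / a l \<noteq> 0" for l using a wpos[of l] by simp
  have "(\<Prod>l\<in>UNIV. (of_nat (w l) / a l) powi (c l + (if l = i then 1 else 0)))
    = (\<Prod>l\<in>UNIV. (of_nat (w l) / a l) powi c l * (if l = i then of_nat (w i) / a i else 1))"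
    using nz by (intro prod.cong refl) (simp add: power_int_add)
  also have "\<dots> = (\<Prod>l\<in>UNIV. (of_nat (w l) / a l) powi c l) * (of_nat (w i) / a i)"
    by (simp add: prod.distrib)
  finally show ?thesis
    using phi_eq[OF is_rep_vertex[OF c(1), of i] c(2), of a] phi_eq[OF c, of a] by (simp add: mult_ac)
qed

text \<open>The degree bound rules out the wrap from class \<open>W - 1\<close> to class
  \<open>0\<close>, at which \<open>phi\<close> would in general pick up a factor other than
  \<open>W\<close>.\<close>

lemma phi_centre:
  assumes "(k, m) \<in> lattice_cone" "k < CARD('d)"
  shows "phi a (k + 1, m) = of_nat W * phi a (k, m)"
proof -
  obtain c j where c: "is_rep c k m j" "j < W" by (rule is_rep_exists)
  have "j + 1 < W" using rep_not_last_class[OF assms(1) c assms(2)] .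
  then show ?thesis using phi_eq[OF is_rep_centre[OF c(1)], of a] phi_eq[OF c, of a] by simp
qed

lemma phi_nonzero: "phi a p \<noteq> 0"
proof -
  obtain k m where p: "p = (k, m)" by (cases p)
  obtain c j where c: "is_rep c k m j" "j < W" by (rule is_rep_exists)
  have nz: "of_nat (w l) / a l \<noteq> 0" for l using a wpos[of l] by simp
  then show ?thesis using phi_eq[OF c, of a] W_pos unfolding p by (simp add: power_int_not_zero)
qed

text \<open>In each vertex term \<open>a j\<close> cancels and leaves \<open>w j\<close>; these add
  up to the factor \<open>W\<close> of the centre term.\<close>

lemma Phi_F0_single:
  assumes "(k, m) \<in> lattice_cone" "k < CARD('d)"
  shows "Phi a (F0 v a * Poly_Mapping.single (k, m) b) = 0"
proof -
  have "Phi a (F0 v a * Poly_Mapping.single (k, m) b)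
    = b * (of_nat W * phi a (k, m)) - (\<Sum>j\<in>UNIV. of_nat (w j) * (b * phi a (k, m)))"
    unfolding F0_mult_single Phi_diff Phi_sum Phi_single phi_centre[OF assms] phi_vertex
    using a by (simp add: mult_ac)
  also have "\<dots> = 0" by (simp add: sum_distrib_right[symmetric] W_def)
  finally show ?thesis .
qed

text \<open>Once \<open>a j\<close> has cancelled, what is left is coordinate \<open>l\<close> of
  the relation among the vertices.\<close>

lemma Phi_Fi_single: "Phi a (Fi v a l * Poly_Mapping.single (k, m) b) = 0"
proof -
  have "Phi a (Fi v a l * Poly_Mapping.single (k, m) b)
    = - (\<Sum>j\<in>UNIV. of_nat (w j) * of_int (v j $ l) * (b * phi a (k, m)))"
    unfolding Fi_mult_single Phi_uminus Phi_sum Phi_single phi_vertex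
    using a by (simp add: mult_ac)
  also have "\<dots> = 0" by (simp add: sum_distrib_right[symmetric] relation_ring)
  finally show ?thesis .
qed

lemma Phi_ideal:
  assumes h: "in_Sk v (CARD('d) - 1) h"
  shows "Phi a (F0 v a * h) = 0" "Phi a (Fi v a l * h) = 0"
proof -
  have eq: "F * h = (\<Sum>p\<in>Poly_Mapping.keys h. F * Poly_Mapping.single p (Poly_Mapping.lookup h p))" for F
    using arg_cong[OF poly_mapping_eq_sum_single[of "Poly_Mapping.keys h" h], of "\<lambda>x. F * x"]
    by (simp add: sum_distrib_left)
  have keys: "\<exists>m. p = (CARD('d) - 1, m) \<and> (CARD('d) - 1, m) \<in> lattice_cone" if "p \<in> Poly_Mapping.keys h" for p
    using h that unfolding in_Sk_iff by (cases p) auto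
  have d: "CARD('d) - 1 < CARD('d)" using zero_less_card_finite[where 'a='d] by simp
  show "Phi a (F0 v a * h) = 0"
    unfolding eq[of "F0 v a"] Phi_sum using keys Phi_F0_single d by (intro sum.neutral ballI) metis
  show "Phi a (Fi v a l * h) = 0"
    unfolding eq[of "Fi v a l"] Phi_sum using keys Phi_Fi_single by (intro sum.neutral ballI) metis
qed

text \<open>The conditions on \<open>R\<close> are those of a residue without the normalisation at
  \<open>H'\<close>. They determine every value from the one at the exponent \<open>mE\<close>,
  whose barycentric coordinates are \<open>1 - w i / W\<close>.\<close>

lemma residue_proportional:
  assumes add: "\<And>g h. in_Sk v CARD('d) g \<Longrightarrow> in_Sk v CARD('d) h \<Longrightarrow> R (g + h) = R g + R h"
    and scale: "\<And>c g. in_Sk v CARD('d) g \<Longrightarrow> R (cst c * g) = c * R g"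
    and R0: "\<And>h. in_Sk v (CARD('d) - 1) h \<Longrightarrow> R (F0 v a * h) = 0"
    and Ri: "\<And>i h. in_Sk v (CARD('d) - 1) h \<Longrightarrow> R (Fi v a i * h) = 0"
  shows "\<exists>\<kappa>. \<forall>g. in_Sk v CARD('d) g \<longrightarrow> R g = \<kappa> * Phi a g"
proof -
  define k where "k = CARD('d) - 1"
  have d: "CARD('d) = k + 1" using zero_less_card_finite[where 'a='d] by (simp add: k_def)
  have S: "in_Sk v CARD('d) (Poly_Mapping.single (k + 1, m) b)" if "(k + 1, m) \<in> lattice_cone" for m b
    unfolding in_Sk_iff using that by (simp add: d)
  have Rzero: "R 0 = 0" using scale[of 0 0] by (simp add: in_Sk_iff)
  have Rsum: "R (\<Sum>x\<in>X. f x) = (\<Sum>x\<in>X. R (f x))" if "\<And>x. x \<in> X \<Longrightarrow> in_Sk v CARD('d) (f x)" for X :: "'x set" and f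
    using that by (induction X rule: infinite_finite_induct) (simp_all add: Rzero add in_Sk_sum)
  define \<rho> where "\<rho> m = R (Poly_Mapping.single (k + 1, m) 1)" for m
  have Rs: "R (Poly_Mapping.single (k + 1, m) b) = b * \<rho> m" if "(k + 1, m) \<in> lattice_cone" for m b
    using scale[OF S[OF that, of 1], of b] by (simp add: cst_mult_single \<rho>_def)
  \<comment> \<open>By \<open>F0\<close> the numbers \<open>a j * \<rho> (m + v j)\<close> sum to
    \<open>\<rho> m\<close>, and by the \<open>Fi\<close> they form a relation among the vertices.
    Hence \<open>kernel\<close> makes them proportional to \<open>w\<close>.\<close>
  have rel: "a i * \<rho> (m + v i) = of_nat (w i) / of_nat W * \<rho> m" if m: "(k, m) \<in> lattice_cone" for m i
  proof -
    have c0: "(k + 1, m) \<in> lattice_cone" using cone_add[OF m cone_centre] by simp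
    have cv: "(k + 1, m + v j) \<in> lattice_cone" for j using cone_add[OF m cone_vertex] by simp
    have h: "in_Sk v (CARD('d) - 1) (Poly_Mapping.single (k, m) 1)" unfolding in_Sk_iff using m by (simp add: k_def)
    let ?r = "\<lambda>i. a i * \<rho> (m + v i)"
    have "F0 v a * Poly_Mapping.single (k, m) 1 =
        Poly_Mapping.single (k + 1, m) 1 + (\<Sum>j\<in>UNIV. Poly_Mapping.single (k + 1, m + v j) (- a j))"
      by (simp add: F0_mult_single single_uminus sum_negf)
    then have "0 = R (Poly_Mapping.single (k + 1, m) 1 + (\<Sum>j\<in>UNIV. Poly_Mapping.single (k + 1, m + v j) (- a j)))"
      using R0[OF h] by simp
    also have "\<dots> = \<rho> m - (\<Sum>j\<in>UNIV. ?r j)"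
      by (subst add) (simp_all add: S c0 cv in_Sk_sum Rsum Rs[simplified] Rs sum_negf del: Suc_eq_plus1 add_Suc_right One_nat_def)
    finally have 1: "(\<Sum>j\<in>UNIV. ?r j) = \<rho> m" by simp
    have 2: "(\<Sum>j\<in>UNIV. ?r j * of_int (v j $ l)) = 0" for l
    proof -
      have "Fi v a l * Poly_Mapping.single (k, m) 1 =
          (\<Sum>j\<in>UNIV. Poly_Mapping.single (k + 1, m + v j) (- (of_int (v j $ l) * a j)))"
        by (simp add: Fi_mult_single single_uminus sum_negf)
      then have "0 = R (\<Sum>j\<in>UNIV. Poly_Mapping.single (k + 1, m + v j) (- (of_int (v j $ l) * a j)))"
        using Ri[OF h, of l] by simp
      also have "\<dots> = (\<Sum>j\<in>UNIV. R (Poly_Mapping.single (k + 1, m + v j) (- (of_int (v j $ l) * a j))))"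
        by (intro Rsum S cv)
      also have "\<dots> = (\<Sum>j\<in>UNIV. - (of_int (v j $ l) * a j) * \<rho> (m + v j))"
        by (intro sum.cong refl Rs cv)
      finally show ?thesis by (simp add: sum_negf mult_ac)
    qed
    define t where "t = (\<Sum>j\<in>UNIV. ?r j * of_int (s j))"
    have r: "?r j = t * of_nat (w j)" for j unfolding t_def by (rule kernel) (rule 2)
    have "\<rho> m = (\<Sum>j\<in>UNIV. t * of_nat (w j))" using 1 by (simp only: r)
    also have "\<dots> = t * of_nat W" by (simp add: W_def sum_distrib_left)
    finally have "\<rho> m = t * of_nat W" .
    then show ?thesis using r[of i] W_pos by simp
  qed
  define mE where "mE = (\<Sum>i\<in>UNIV. v i)"
  \<comment> \<open>Induction on \<open>W - j\<close>. If some coordinate is at least one, that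
    vertex is exchanged for the centre without leaving the cone, which raises \<open>j\<close> by
    one and keeps it below \<open>W\<close>. Otherwise \<open>m = mE\<close>.\<close>
  have claim: "\<rho> m * phi a (k + 1, mE) = phi a (k + 1, m) * \<rho> mE"
    if "(k + 1, m) \<in> lattice_cone" "is_rep c (k + 1) m j" "j < W" for m c j
    using that
  proof (induction "W - j" arbitrary: m c j rule: less_induct)
    case less
    let ?x = "\<lambda>i. of_int (c i) + j * (w i / W)"
    have bx: "bary ?x (k + 1) m" using bary_of_rep[OF less.prems(2)] by simp
    show ?case
    proof (cases "\<exists>i. 1 \<le> ?x i")
      case True
      then obtain i where i: "1 \<le> ?x i" by blast
      let ?c = "\<lambda>l. c l - (if l = i then 1 else 0)"
      have c': "is_rep ?c k (m - v i) j" using is_rep_vertex'[OF less.prems(2)] .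
      have cone: "(k, m - v i) \<in> lattice_cone"
      proof -
        have "0 \<le> of_int (?c l) + j * (w l / W)" for l
          using rep_nonneg[OF less.prems(1,2), of l] i by auto
        with bary_of_rep[OF c'] show ?thesis
          unfolding lattice_cone_def mem_Collect_eq prod.case by (intro exI conjI allI)
      qed
      have kd: "k < CARD('d)" by (simp add: d)
      have j: "j + 1 < W" using rep_not_last_class[OF cone c' less.prems(3) kd] .
      have cone1: "(k + 1, m - v i) \<in> lattice_cone" using cone_add[OF cone cone_centre] by simp
      have IH: "\<rho> (m - v i) * phi a (k + 1, mE) = phi a (k + 1, m - v i) * \<rho> mE"
        by (rule less.hyps[OF _ cone1 is_rep_centre[OF c'] j]) (use j in auto)
      have "\<rho> m = of_nat (w i) / (of_nat W * a i) * \<rho> (m - v i)"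
        using rel[OF cone, of i] a[of i] W_pos by (simp add: field_simps)
      then have "\<rho> m * phi a (k + 1, mE) = of_nat (w i) / (of_nat W * a i) * (phi a (k + 1, m - v i) * \<rho> mE)"
        by (simp only: IH[symmetric] mult.assoc)
      also have "phi a (k + 1, m - v i) = of_nat W * phi a (k, m - v i)" by (rule phi_centre[OF cone kd])
      also have "of_nat (w i) / (of_nat W * a i) * (of_nat W * phi a (k, m - v i) * \<rho> mE)
          = of_nat (w i) / a i * phi a (k, m - v i) * \<rho> mE"
        using W_pos by simp
      also have "of_nat (w i) / a i * phi a (k, m - v i) = phi a (k + 1, m)"
        using phi_vertex[of k "m - v i" i] by simp
      finally show ?thesis .
    next
      case False
      \<comment> \<open>As \<open>w i\<close> divides \<open>W\<close>, both \<open>?x i\<close> and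
        \<open>1\<close> are integer multiples of \<open>w i / W\<close>; a coordinate below one is
        therefore at most \<open>1 - w i / W\<close>.\<close>
      have le: "?x i \<le> 1 - w i / W" for i
      proof -
        obtain q where q: "W = w i * q" using wdvd[of i] by (auto simp: W_def dvd_def)
        have "q > 0" using W_pos q by (cases q) auto
        have x: "?x i = of_int (c i * int q + int j) / q" "w i / W = 1 / real q"
          using \<open>q > 0\<close> wpos[of i] by (simp_all add: q field_simps)
        have "?x i < 1" using False by (simp add: not_le)
        then have "real_of_int (c i * int q + int j) < real q"
          using \<open>q > 0\<close> unfolding x(1) by (subst (asm) divide_less_eq_1_pos) auto
        then have "c i * int q + int j < int q" by linarith
        then have "real_of_int (c i * int q + int j) \<le> real q - 1" by linarith
        then have "?x i \<le> (real q - 1) / q" unfolding x(1) by (intro divide_right_mono) auto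
        then show ?thesis using \<open>q > 0\<close> unfolding x(2) by (simp add: diff_divide_distrib)
      qed
      \<comment> \<open>The upper bounds sum to \<open>n - 1\<close>, the coordinates to the degree
        \<open>k + 1 = d\<close>. These agree, so every bound is attained.\<close>
      have sum0: "(\<Sum>i\<in>UNIV. (1 - w i / W) - ?x i) = 0"
        using bx bary_centre card d by (simp add: bary_def sum_subtractf)
      have all: "\<forall>i\<in>UNIV. (1 - w i / W) - ?x i = 0"
        using sum0 by (subst (asm) sum_nonneg_eq_0_iff) (use le in auto)
      have x: "?x i = 1 - w i / W" for i using bspec[OF all UNIV_I, of i] by linarith
      have "m $ l = mE $ l" for l
      proof -
        have "real_of_int (m $ l) = (\<Sum>i\<in>UNIV. ?x i * of_int (v i $ l))" using bx by (simp only: bary_def)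
        also have "\<dots> = (\<Sum>i\<in>UNIV. of_int (v i $ l)) - (\<Sum>i\<in>UNIV. w i / W * of_int (v i $ l))"
          by (simp only: x left_diff_distrib sum_subtractf mult_1)
        also have "(\<Sum>i\<in>UNIV. w i / W * of_int (v i $ l)) = 0" using bary_centre by (simp add: bary_def)
        finally have "real_of_int (m $ l) = real_of_int (mE $ l)" by (simp add: mE_def)
        then show ?thesis by (simp only: of_int_eq_iff)
      qed
      then have "m = mE" by (simp add: vec_eq_iff)
      then show ?thesis by simp
    qed
  qed
  define \<kappa> where "\<kappa> = \<rho> mE / phi a (k + 1, mE)"
  have \<rho>: "\<rho> m = \<kappa> * phi a (k + 1, m)" if "(k + 1, m) \<in> lattice_cone" for m
  proof -
    obtain c j where c: "is_rep c (k + 1) m j" "j < W" by (rule is_rep_exists)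
    show ?thesis using claim[OF that c] phi_nonzero[of "(k + 1, mE)"] by (simp add: \<kappa>_def field_simps)
  qed
  have "R g = \<kappa> * Phi a g" if g: "in_Sk v CARD('d) g" for g
  proof -
    have keys: "\<exists>m. p = (k + 1, m) \<and> (k + 1, m) \<in> lattice_cone" if "p \<in> Poly_Mapping.keys g" for p
      using g that unfolding in_Sk_iff by (cases p) (auto simp: d)
    have "R g = R (\<Sum>p\<in>Poly_Mapping.keys g. Poly_Mapping.single p (Poly_Mapping.lookup g p))"
      by (rule arg_cong[OF poly_mapping_eq_sum_single]) auto
    also have "\<dots> = (\<Sum>p\<in>Poly_Mapping.keys g. R (Poly_Mapping.single p (Poly_Mapping.lookup g p)))"
      using keys S by (intro Rsum) blast
    also have "\<dots> = (\<Sum>p\<in>Poly_Mapping.keys g. \<kappa> * (Poly_Mapping.lookup g p * phi a p))"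
    proof (rule sum.cong[OF refl])
      fix p assume "p \<in> Poly_Mapping.keys g"
      then obtain m where "p = (k + 1, m)" "(k + 1, m) \<in> lattice_cone" using keys by blast
      then show "R (Poly_Mapping.single p (Poly_Mapping.lookup g p)) = \<kappa> * (Poly_Mapping.lookup g p * phi a p)"
        using Rs[of m] \<rho>[of m] by simp
    qed
    finally show ?thesis by (simp add: Phi_def sum_distrib_left)
  qed
  then show ?thesis by blast
qed

text \<open>\<open>Phi\<close> rescaled to the prescribed value at \<open>H'\<close> is a residue,
  and by \<open>residue_proportional\<close> the only one, so the definite description denotes
  it.\<close>

lemma toric_res_eq:
  assumes H: "in_Sk v CARD('d) (Hf v a)" and nz: "Phi a (Hf v a) \<noteq> 0" and g: "in_Sk v CARD('d) g"
  shows "toric_res v a g = complex_of_real (VolDelta v) / Phi a (Hf v a) * Phi a g"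
proof -
  define \<kappa> where "\<kappa> = complex_of_real (VolDelta v) / Phi a (Hf v a)"
  \<comment> \<open>The value zero outside degree \<open>d\<close> follows the convention of
    \<open>is_toric_res\<close> and is what makes uniqueness hold as an equality of
    functions.\<close>
  define R0 where "R0 = (\<lambda>g. if in_Sk v CARD('d) g then \<kappa> * Phi a g else 0)"
  have S1: "in_Sk v CARD('d) (F * h)" if "in_Sk v 1 F" "in_Sk v (CARD('d) - 1) h" for F h
    using in_Sk_mult[OF that] zero_less_card_finite[where 'a='d] by simp
  have F: "in_Sk v 1 (F0 v a)" "in_Sk v 1 (Fi v a l)" for l
    unfolding in_Sk_iff using keys_F0[of a] keys_Fi[of a l] cone_vertex cone_centre by auto
  have Sc: "in_Sk v CARD('d) (cst c * g)" if "in_Sk v CARD('d) g" for c g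
    using in_Sk_mult[OF _ that, of 0 "cst c"] cone_zero by (simp add: in_Sk_iff cst_def)
  have R0: "is_toric_res v a R0"
    unfolding is_toric_res_def using H nz S1 F
    by (auto simp: R0_def in_Sk_add Sc Phi_add Phi_cst Phi_ideal distrib_left \<kappa>_def)
  have "toric_res v a = R0"
    unfolding toric_res_def
  proof (rule the_equality[where a = R0])
    show "is_toric_res v a R0" by (rule R0)
    fix R assume R: "is_toric_res v a R"
    then obtain \<kappa>' where \<kappa>': "\<And>g. in_Sk v CARD('d) g \<Longrightarrow> R g = \<kappa>' * Phi a g"
      using residue_proportional[of R] unfolding is_toric_res_def by blast
    have "R (Hf v a) = complex_of_real (VolDelta v)" using R unfolding is_toric_res_def by blast
    then have "\<kappa>' = \<kappa>" using \<kappa>'[OF H] nz by (simp add: \<kappa>_def eq_divide_eq)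
    moreover have "R g = 0" if "\<not> in_Sk v CARD('d) g" for g using R that unfolding is_toric_res_def by blast
    ultimately show "R = R0" using \<kappa>' by (auto simp: R0_def)
  qed
  then show ?thesis using g by (simp add: R0_def \<kappa>_def)
qed

end

end

section \<open>The toric Hessian\<close>

lemma sum_option: "(\<Sum>x\<in>UNIV. f x) = f None + (\<Sum>l\<in>(UNIV::'a::finite set). f (Some l))"
  by (simp add: UNIV_option_conv sum.reindex)

lemma det_of_int:
  fixes A :: "int^'a::finite^'a"
  shows "det (\<chi> i j. (of_int (A $ i $ j) :: 'r::comm_ring_1)) = of_int (det A)"
  by (simp add: det_def)

lemma bij_option_exists:
  assumes "CARD('n::finite) = CARD('d::finite) + 1"
  shows "\<exists>\<sigma> :: 'd option \<Rightarrow> 'n. bij \<sigma>"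
  using finite_same_card_bij[of "UNIV :: 'd option set" "UNIV :: 'n set"] assms by (auto simp: card_UNIV_option)

lemma det_option_block:
  fixes A :: "'r::comm_ring_1^('a::finite option)^('a option)"
  assumes "\<And>l. A $ None $ Some l = 0"
  shows "det A = A $ None $ None * det (\<chi> i j. A $ Some i $ Some j)"
proof -
  have R: "-range Some = {None :: 'a option}" using notin_range_Some by auto
  have "A $ i $ j = 0" if "i \<notin> range Some" "i \<noteq> j" for i j
    using that assms by (cases i; cases j) auto
  from det_pad[OF _ this, of Some] show ?thesis unfolding R by simp
qed

lemma of_int_eq_cst: "(of_int k :: 'd::finite LP) = cst (of_int k)"
  by (simp add: cst_def zero_prod_def[symmetric])

lemma cst_sum: "cst (\<Sum>x\<in>X. f x) = (\<Sum>x\<in>X. cst (f x))"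
  by (induction X rule: infinite_finite_induct) (simp_all add: cst_0 cst_add)

context split_simplex
begin

lemma theta_neg_sum_single:
  "theta l (- (\<Sum>j\<in>UNIV. Poly_Mapping.single (0, v j) (b j))) = - (\<Sum>j\<in>UNIV. Poly_Mapping.single (0, v j) (of_int (v j $ l) * b j))"
proof (rule poly_mapping_eqI)
  fix km :: "nat \<times> (int^'d)"
  have 2: "of_int (snd km $ l) * (b j when (0, v j) = km) = (of_int (v j $ l) * b j when (0, v j) = km)" for j
    by (cases km) (simp add: when_def)
  show "Poly_Mapping.lookup (theta l (- (\<Sum>j\<in>UNIV. Poly_Mapping.single (0, v j) (b j)))) km =
      Poly_Mapping.lookup (- (\<Sum>j\<in>UNIV. Poly_Mapping.single (0, v j) (of_int (v j $ l) * b j))) km"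
    by (simp add: theta_eq lookup_sum lookup_single sum_distrib_left 2)
qed

definition vertex_term :: "('n \<Rightarrow> complex) \<Rightarrow> 'n \<Rightarrow> 'd LP" where
  "vertex_term a i = Poly_Mapping.single (0, v i) (- a i)"

lemma prod_vertex_term: "(\<Prod>i\<in>X. vertex_term a i) = Poly_Mapping.single (0, \<Sum>i\<in>X. v i) (\<Prod>i\<in>X. - a i)"
  by (induction X rule: infinite_finite_induct)
    (simp_all add: vertex_term_def mult_single zero_prod_def[symmetric])

section \<open>Volume of the simplex and expansion of the Hessian\<close>

context
  fixes \<sigma> :: "'d option \<Rightarrow> 'n"
  assumes \<sigma>: "bij \<sigma>"
begin

text \<open>The columns are the homogenised vertices \<open>(1, v i)\<close>, labelled through
  \<open>\<sigma>\<close> by the index set of the matrix \<open>Mf\<close>.\<close>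

definition Vm :: "int^('d option)^('d option)" where
  "Vm = (\<chi> r c. case r of None \<Rightarrow> 1 | Some l \<Rightarrow> v (\<sigma> c) $ l)"

lemma Vm_nth [simp]: "Vm $ None $ c = 1" "Vm $ Some l $ c = v (\<sigma> c) $ l"
  by (simp_all add: Vm_def)

lemma sum_sigma: "(\<Sum>x\<in>UNIV. f (\<sigma> x)) = (\<Sum>i\<in>UNIV. f i)"
  using sum.reindex_bij_betw[OF \<sigma>] .

lemma sigma_eq_iff: "\<sigma> r = \<sigma> c \<longleftrightarrow> r = c"
  using \<sigma> by (auto simp: bij_def inj_def)

text \<open>The integer matrix \<open>D\<close> with rows \<open>w\<close> and \<open>C l\<close> is
  invertible by \<open>split\<close>, and its product with the transpose of \<open>Vm\<close> is
  block triangular with diagonal blocks \<open>W\<close> and the identity. The square removes the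
  sign, which depends on the labelling.\<close>

lemma det_Vm_square: "det Vm ^ 2 = int W ^ 2"
proof -
  define Q where "Q = (\<chi> r c. case c of None \<Rightarrow> s (\<sigma> r) | Some l \<Rightarrow> v (\<sigma> r) $ l)"
  define D where "D = (\<chi> r c. case r of None \<Rightarrow> int (w (\<sigma> c)) | Some l \<Rightarrow> C l (\<sigma> c))"
  have "Q ** D = mat 1"
    using split by (simp add: vec_eq_iff matrix_matrix_mult_def Q_def D_def sum_option mat_def sigma_eq_iff add.commute)
  then have QD: "det Q * det D = 1" by (metis det_I det_mul)
  define A where "A = transpose (Vm ** transpose D)"
  have A: "A $ r $ c = (\<Sum>x\<in>UNIV. Vm $ c $ x * D $ r $ x)" for r c
    by (simp add: A_def transpose_def matrix_matrix_mult_def)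
  have N: "A $ None $ None = int W"
    using sum_sigma[of "\<lambda>i. int (w i)"] by (simp add: A D_def W_def)
  have NS: "A $ None $ Some l = 0" for l
    using sum_sigma[of "\<lambda>i. int (w i) * v i $ l"] relation[of l] by (simp add: A D_def mult.commute)
  have SS: "A $ Some l $ Some k = (if l = k then 1 else 0)" for l k
    using sum_sigma[of "\<lambda>i. C l i * v i $ k"] sect[of l k] by (simp add: A D_def mult.commute)
  have "det A = A $ None $ None * det (\<chi> i j. A $ Some i $ Some j)"
    by (rule det_option_block[OF NS])
  also have "(\<chi> i j. A $ Some i $ Some j) = mat 1" by (simp add: vec_eq_iff SS mat_def)
  finally have "det A = int W" by (simp add: N)
  then have "int W = det Vm * det D" by (simp add: A_def det_mul)
  moreover have "det D ^ 2 = 1" using QD by (auto simp: zmult_eq_1_iff)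
  ultimately show ?thesis by (simp add: power_mult_distrib)
qed

text \<open>Subtracting column \<open>None\<close> of \<open>Vm\<close> from the others leaves the
  matrix \<open>B\<close> of edge vectors at one vertex, whose determinant gives the volume.\<close>

lemma VolDelta_eq: "VolDelta v = W"
proof -
  define B where "B = (\<chi> i j. v (\<sigma> (Some j)) $ i - v (\<sigma> None) $ i)"
  \<comment> \<open>The unimodular column operation that subtracts column \<open>None\<close> from
    every other column.\<close>
  define T :: "int^('d option)^('d option)" where "T = (\<chi> r c. if r = c then 1 else if r = None then - 1 else 0)"
  have "det (transpose T) = transpose T $ None $ None * det (\<chi> i j. transpose T $ Some i $ Some j)"
    by (rule det_option_block) (simp add: T_def transpose_def)
  also have "(\<chi> i j. transpose T $ Some i $ Some j) = mat 1" by (auto simp: vec_eq_iff T_def transpose_def mat_def)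
  also have "transpose T $ None $ None = 1" by (simp add: T_def transpose_def)
  finally have T1: "det T = 1" by simp
  have prod: "(Vm ** T) $ r $ None = Vm $ r $ None" "(Vm ** T) $ r $ Some l = Vm $ r $ Some l - Vm $ r $ None" for r l
    by (simp_all add: matrix_matrix_mult_def T_def sum_option if_distrib cong: if_cong)
  have "det (Vm ** T) = (Vm ** T) $ None $ None * det (\<chi> i j. (Vm ** T) $ Some i $ Some j)"
    by (rule det_option_block) (simp add: prod)
  also have "\<dots> = det B"
    by (simp add: prod B_def)
  finally have "det B = det Vm" by (simp add: det_mul T1)
  then have "det B ^ 2 = int W ^ 2" using det_Vm_square by simp
  then have detB: "\<bar>det B\<bar> = int W" by (simp add: power2_eq_iff) auto
  have inj: "inj (\<lambda>i. rvec (v i))"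
    using inj_v by (auto simp: inj_def rvec_def vec_eq_iff)
  let ?X = "range (\<lambda>i. rvec (v i))"
  have "measure lborel (convex hull ?X)
      = \<bar>det (\<chi> i j. rvec (v (\<sigma> (Some j))) $ i - rvec (v (\<sigma> None)) $ i)\<bar> / fact CARD('d)"
  proof (rule content_simplex_finite)
    show "card ?X = Suc CARD('d)" using inj card by (simp add: card_image)
    have "inj (\<lambda>l. rvec (v (\<sigma> (Some l))))"
      by (auto intro!: injI dest!: injD[OF inj] simp: sigma_eq_iff)
    moreover have "?X = insert (rvec (v (\<sigma> None))) (range (\<lambda>l. rvec (v (\<sigma> (Some l)))))"
    proof -
      have "(UNIV :: 'n set) = \<sigma> ` insert None (range Some)"
        using \<sigma> by (simp add: bij_is_surj flip: UNIV_option_conv)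
      then have "?X = (\<lambda>i. rvec (v i)) ` \<sigma> ` insert None (range Some)" by simp
      then show ?thesis by (simp add: image_image)
    qed
    moreover have "rvec (v (\<sigma> None)) \<notin> range (\<lambda>l. rvec (v (\<sigma> (Some l))))"
      by (auto intro!: injI dest!: injD[OF inj] simp: sigma_eq_iff)
    ultimately show "bij_betw (\<lambda>l. rvec (v (\<sigma> (Some l)))) UNIV (?X - {rvec (v (\<sigma> None))})"
      by (simp add: bij_betw_def)
  qed auto
  also have "(\<chi> i j. rvec (v (\<sigma> (Some j))) $ i - rvec (v (\<sigma> None)) $ i) = (\<chi> i j. real_of_int (B $ i $ j))"
    by (simp add: B_def rvec_def)
  also have "\<bar>det (\<chi> i j. real_of_int (B $ i $ j))\<bar> = real_of_int \<bar>det B\<bar>" by (simp add: det_of_int)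
  finally have "measure lborel (convex hull ?X) = W / fact CARD('d)" by (simp add: detB)
  moreover have "measure lebesgue (convex hull ?X) = measure lborel (convex hull ?X)"
    by (intro measure_completion) (auto intro!: borel_closed compact_imp_closed finite_imp_compact_convex_hull)
  ultimately show ?thesis by (simp add: VolDelta_def Delta_def)
qed

text \<open>The unit vector of index \<open>None\<close> is \<open>Vm\<close> applied to \<open>w / W\<close>, so the constant term of \<open>f\<close>
  becomes a rank one perturbation of a diagonal matrix.\<close>

lemma Mf_eq:
  fixes a :: "'n \<Rightarrow> complex"
  defines "VL \<equiv> (\<chi> r c. of_int (Vm $ r $ c)) :: ('d LP)^('d option)^('d option)"
  defines "K \<equiv> \<chi> r c. (if r = c then vertex_term a (\<sigma> r) else 0) + cst (of_nat (w (\<sigma> r)) / of_nat W) * cst (of_nat (w (\<sigma> c)) / of_nat W)"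
  shows "Mf v a = VL ** K ** transpose VL"
proof -
  define u where "u = (\<lambda>r. cst (of_nat (w (\<sigma> r)) / of_nat W) :: 'd LP)"
  have e0: "(\<Sum>c\<in>UNIV. VL $ r $ c * u c) = (if r = None then 1 else 0)" for r
  proof -
    have "(\<Sum>c\<in>UNIV. VL $ r $ c * u c) = cst (\<Sum>c\<in>UNIV. of_int (Vm $ r $ c) * (of_nat (w (\<sigma> c)) / of_nat W))"
      by (simp add: VL_def u_def of_int_eq_cst cst_mult[symmetric] cst_sum)
    also have "(\<Sum>c\<in>UNIV. of_int (Vm $ r $ c) * (of_nat (w (\<sigma> c)) / of_nat W)) = (if r = None then 1 else (0::complex))"
    proof (cases r)
      case None
      then have "(\<Sum>c\<in>UNIV. of_int (Vm $ r $ c) * (of_nat (w (\<sigma> c)) / of_nat W)) = (\<Sum>i\<in>UNIV. of_nat (w i) / complex_of_nat W)"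
        using sum_sigma[of "\<lambda>i. of_nat (w i) / complex_of_nat W"] by simp
      also have "\<dots> = of_nat W / of_nat W" by (simp only: sum_divide_distrib[symmetric] W_def of_nat_sum)
      finally show ?thesis using None W_pos by simp
    next
      case (Some l)
      then have "(\<Sum>c\<in>UNIV. of_int (Vm $ r $ c) * (of_nat (w (\<sigma> c)) / of_nat W))
          = (\<Sum>i\<in>UNIV. of_nat (w i) * of_int (v i $ l) / complex_of_nat W)"
        using sum_sigma[of "\<lambda>i. of_nat (w i) * of_int (v i $ l) / complex_of_nat W"] by (simp add: mult.commute)
      also have "\<dots> = 0" by (simp add: sum_divide_distrib[symmetric] relation_ring)
      finally show ?thesis using Some by simp
    qed
    finally show ?thesis by (simp add: cst_1 cst_0)
  qed
  \<comment> \<open>The rank one part yields the constant term of \<open>f\<close>, present only in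
    the corner entry. A vertex enters with the product of its entries in rows \<open>r\<close> and
    \<open>r'\<close>, namely \<open>1\<close> or the exponents brought down by
    \<open>theta\<close>.\<close>
  have ent: "(VL ** K ** transpose VL) $ r $ r' =
     (if r = None then 1 else 0) * (if r' = None then 1 else 0) +
     (\<Sum>c\<in>UNIV. of_int (Vm $ r $ c * Vm $ r' $ c) * vertex_term a (\<sigma> c))" for r r'
  proof -
    define t where "t = (\<Sum>b\<in>UNIV. VL $ r $ b * u b)"
    have "(VL ** K) $ r $ c = VL $ r $ c * vertex_term a (\<sigma> c) + t * u c" for c
      unfolding t_def by (simp add: matrix_matrix_mult_def K_def distrib_left sum.distrib if_distrib[of "(*) _"] sum_distrib_right u_def mult.assoc cong: if_cong)
    then have "(VL ** K ** transpose VL) $ r $ r' =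
      (\<Sum>c\<in>UNIV. VL $ r $ c * vertex_term a (\<sigma> c) * VL $ r' $ c) + t * (\<Sum>c\<in>UNIV. VL $ r' $ c * u c)"
      by (simp add: matrix_matrix_mult_def[of "VL ** K"] transpose_def distrib_right distrib_left sum.distrib sum_distrib_left mult_ac)
    then show ?thesis unfolding e0 t_def by (simp add: VL_def mult_ac)
  qed
  have sum: "(\<Sum>c\<in>UNIV. of_int (h (\<sigma> c)) * vertex_term a (\<sigma> c)) = - (\<Sum>i\<in>UNIV. Poly_Mapping.single (0, v i) (of_int (h i) * a i))" for h :: "'n \<Rightarrow> int"
    using sum_sigma[of "\<lambda>i. of_int (h i) * vertex_term a i"]
    by (simp add: vertex_term_def of_int_eq_cst cst_mult_single single_uminus sum_negf)
  have one: "mon 0 0 = (1 :: 'd LP)" by (simp add: mon_def zero_prod_def[symmetric])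
  have "Mf v a $ r $ r' = (VL ** K ** transpose VL) $ r $ r'" for r r'
  proof (cases r; cases r')
    assume "r = None" "r' = None"
    then show ?thesis using sum[of "\<lambda>_. 1"] by (simp add: ent Mf_def fpoly_def one)
  next
    fix l assume "r = None" "r' = Some l"
    then show ?thesis using sum[of "\<lambda>i. v i $ l"] by (simp add: ent Mf_def theta_fpoly)
  next
    fix l assume "r = Some l" "r' = None"
    then show ?thesis using sum[of "\<lambda>i. v i $ l"] by (simp add: ent Mf_def theta_fpoly)
  next
    fix l l' assume "r = Some l" "r' = Some l'"
    then show ?thesis using sum[of "\<lambda>i. v i $ l * v i $ l'"]
      by (simp add: ent Mf_def theta_fpoly theta_neg_sum_single mult.assoc)
  qed
  then show ?thesis by (simp add: vec_eq_iff)
qed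

text \<open>In the factorisation \<open>Mf_eq\<close> the outer determinants multiply to
  \<open>W ^ 2\<close> and the inner one is diagonal plus rank one. Its terms are the product of all
  vertex terms of \<open>f\<close> and the products omitting one vertex.\<close>

lemma Hf_eq:
  "Hf v a = cst (of_nat W ^ 2) * (Poly_Mapping.single (CARD('d), \<Sum>i\<in>UNIV. v i) (\<Prod>i\<in>UNIV. - a i) +
     (\<Sum>k\<in>UNIV. Poly_Mapping.single (CARD('d), \<Sum>i\<in>-{k}. v i) ((of_nat (w k) / of_nat W)\<^sup>2 * (\<Prod>i\<in>-{k}. - a i))))"
proof -
  have sq: "(of_int (det Vm) :: 'd LP) * of_int (det Vm) = cst (of_nat W ^ 2)"
  proof -
    have "(of_int (det Vm) :: 'd LP) * of_int (det Vm) = of_int (det Vm ^ 2)" by (simp add: power2_eq_square)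
    also have "\<dots> = of_int (int W ^ 2)" by (simp only: det_Vm_square)
    finally show ?thesis by (simp only: of_int_eq_cst) simp
  qed
  let ?u = "\<lambda>k. cst (of_nat (w k) / of_nat W) :: 'd LP"
  have "det (Mf v a) = cst (of_nat W ^ 2) * det (\<chi> r c. (if r = c then vertex_term a (\<sigma> r) else 0) + ?u (\<sigma> r) * ?u (\<sigma> c))"
    unfolding Mf_eq det_mul det_transpose det_of_int sq[symmetric] by (simp add: mult_ac)
  also have "det (\<chi> r c. (if r = c then vertex_term a (\<sigma> r) else 0) + ?u (\<sigma> r) * ?u (\<sigma> c)) =
     (\<Prod>r\<in>UNIV. vertex_term a (\<sigma> r)) + (\<Sum>k\<in>UNIV. ?u (\<sigma> k) * ?u (\<sigma> k) * (\<Prod>r\<in>-{k}. vertex_term a (\<sigma> r)))"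
    by (rule det_diagonal_plus_rank_one)
  also have "(\<Prod>r\<in>UNIV. vertex_term a (\<sigma> r)) = (\<Prod>i\<in>UNIV. vertex_term a i)"
    using prod.reindex_bij_betw[OF \<sigma>] .
  also have "(\<Sum>k\<in>UNIV. ?u (\<sigma> k) * ?u (\<sigma> k) * (\<Prod>r\<in>-{k}. vertex_term a (\<sigma> r)))
      = (\<Sum>k\<in>UNIV. ?u (\<sigma> k) * ?u (\<sigma> k) * (\<Prod>i\<in>-{\<sigma> k}. vertex_term a i))"
  proof (rule sum.cong[OF refl])
    fix k
    have "bij_betw \<sigma> (-{k}) (-{\<sigma> k})"
      using \<sigma> by (auto simp: bij_betw_def inj_on_def bij_def inj_def)
    from prod.reindex_bij_betw[OF this, of "vertex_term a"]
    show "?u (\<sigma> k) * ?u (\<sigma> k) * (\<Prod>r\<in>-{k}. vertex_term a (\<sigma> r)) = ?u (\<sigma> k) * ?u (\<sigma> k) * (\<Prod>i\<in>-{\<sigma> k}. vertex_term a i)"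
      by simp
  qed
  also have "\<dots> = (\<Sum>k\<in>UNIV. ?u k * ?u k * (\<Prod>i\<in>-{k}. vertex_term a i))"
    by (rule sum_sigma)
  finally have det: "det (Mf v a) = cst (of_nat W ^ 2) * ((\<Prod>i\<in>UNIV. vertex_term a i) + (\<Sum>k\<in>UNIV. ?u k * ?u k * (\<Prod>i\<in>-{k}. vertex_term a i)))" .
  have mon: "mon CARD('d) 0 * Poly_Mapping.single (0, m) b = Poly_Mapping.single (CARD('d), m) b" for m :: "int^'d" and b
    by (simp add: mon_def mult_single)
  show ?thesis
    unfolding Hf_def det prod_vertex_term
    by (simp add: mult.left_commute[of "mon CARD('d) 0"] distrib_left sum_distrib_left mon cst_mult_single
        cst_mult[symmetric] power2_eq_square mult.assoc)
qed

end

section \<open>Values of the functional at the Hessian and at \<open>P\<close>\<close>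

lemma facet_rep: "is_rep (\<lambda>j. if j \<in> -{k} then 1 else 0) CARD('d) (\<Sum>i\<in>-{k}. v i) 0"
proof -
  have R: "(\<Sum>i\<in>UNIV. (if i \<in> -{k} then f i else 0)) = sum f (-{k})" for f :: "'n \<Rightarrow> int"
    using sum.inter_restrict[of UNIV f "-{k}"] by simp
  have c: "card (-{k}) = CARD('d)" using card by (simp add: Compl_eq_Diff_UNIV card_Diff_subset)
  have "(\<Sum>i\<in>UNIV. (if i \<in> -{k} then 1 else 0) * v i $ l) = (\<Sum>i\<in>-{k}. v i) $ l" for l
    using R[of "\<lambda>i. v i $ l"] by (simp add: if_distrib[of "\<lambda>x. x * _"] cong: if_cong)
  then show ?thesis unfolding is_rep_def R by (simp add: c)
qed

lemma facet_cone: "(CARD('d), \<Sum>i\<in>-{k}. v i) \<in> lattice_cone"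
proof -
  have "0 \<le> of_int (if j \<in> -{k} then 1 else 0) + real 0 * (w j / W)" for j by simp
  with bary_of_rep[OF facet_rep[of k]] show ?thesis
    unfolding lattice_cone_def mem_Collect_eq prod.case by (intro exI conjI allI)
qed

text \<open>With unit coefficients the total would be \<open>d + 1\<close>. Removing
  \<open>w\<close> lowers it by \<open>W\<close>, and \<open>W - 1\<close> copies of the centre
  restore it to \<open>d\<close>, so this exponent lies in the last class.\<close>

lemma vertex_sum_rep: "is_rep (\<lambda>i. 1 - int (w i)) CARD('d) (\<Sum>i\<in>UNIV. v i) (W - 1)"
proof -
  have "(\<Sum>i\<in>UNIV. int (w i)) = int W" by (simp add: W_def)
  then show ?thesis
    using card W_pos relation by (simp add: is_rep_def left_diff_distrib sum_subtractf of_nat_diff)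
qed

lemma vertex_sum_cone: "(CARD('d), \<Sum>i\<in>UNIV. v i) \<in> lattice_cone"
proof -
  have "0 \<le> of_int (1 - int (w i)) + real (W - 1) * (w i / W)" for i
  proof -
    have "w i \<le> W" unfolding W_def by (rule member_le_sum) auto
    then have "0 \<le> 1 - w i / W" using W_pos by simp
    also have "1 - w i / W = of_int (1 - int (w i)) + real (W - 1) * (w i / W)"
      using W_pos by (simp add: of_nat_diff field_simps)
    finally show ?thesis .
  qed
  with bary_of_rep[OF vertex_sum_rep] show ?thesis
    unfolding lattice_cone_def mem_Collect_eq prod.case by (intro exI conjI allI)
qed


lemma in_Sk_Hf: "in_Sk v CARD('d) (Hf v a)"
proof -
  obtain \<sigma> :: "'d option \<Rightarrow> 'n" where \<sigma>: "bij \<sigma>" using bij_option_exists[OF card] by blast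
  have single: "in_Sk v CARD('d) (Poly_Mapping.single (CARD('d), m) b)" if "(CARD('d), m) \<in> lattice_cone" for m b
    unfolding in_Sk_iff using that by simp
  have cst: "in_Sk v 0 (cst c)" for c
    unfolding in_Sk_iff cst_def using cone_zero by simp
  show ?thesis unfolding Hf_eq[OF \<sigma>]
    using in_Sk_mult[OF cst in_Sk_add[OF single[OF vertex_sum_cone] in_Sk_sum[OF single[OF facet_cone]]]] by simp
qed

text \<open>The facet monomials lie in class zero and together account for the \<open>1\<close> in
  the last factor; the sum of all vertices lies in class \<open>W - 1\<close> and produces the power
  product of the \<open>a i\<close>. This value is the source of the denominator of the
  residue.\<close>

lemma Phi_Hf:
  assumes a: "\<And>i. a i \<noteq> 0"
  shows "Phi a (Hf v a) = (-1) ^ CARD('d) * of_nat W * (\<Prod>i\<in>UNIV. of_nat (w i)) *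
    (1 - of_nat (W ^ W) / of_nat (\<Prod>i\<in>UNIV. w i ^ w i) * (\<Prod>i\<in>UNIV. a i ^ w i))"
proof -
  obtain \<sigma> :: "'d option \<Rightarrow> 'n" where \<sigma>: "bij \<sigma>" using bij_option_exists[OF card] by blast
  let ?w = "\<lambda>i. complex_of_nat (w i)"
  let ?P = "\<Prod>i\<in>UNIV. ?w i"
  have wnz: "?w i \<noteq> 0" for i using wpos[of i] by simp
  have facet: "(\<Prod>i\<in>-{k}. - a i) * phi a (CARD('d), \<Sum>i\<in>-{k}. v i) = (-1) ^ CARD('d) * (\<Prod>i\<in>-{k}. ?w i)" for k
  proof -
    have c: "card (-{k}) = CARD('d)" using card by (simp add: Compl_eq_Diff_UNIV card_Diff_subset)
    have "phi a (CARD('d), \<Sum>i\<in>-{k}. v i) = (\<Prod>i\<in>UNIV. (?w i / a i) powi (if i \<in> -{k} then 1 else 0))"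
      using phi_eq[OF facet_rep W_pos, of a k] by simp
    also have "\<dots> = (\<Prod>i\<in>UNIV. if i \<in> -{k} then ?w i / a i else 1)" by (intro prod.cong) auto
    also have "\<dots> = (\<Prod>i\<in>-{k}. ?w i / a i)" using prod.inter_restrict[of UNIV "\<lambda>i. ?w i / a i" "-{k}"] by simp
    finally have "(\<Prod>i\<in>-{k}. - a i) * phi a (CARD('d), \<Sum>i\<in>-{k}. v i) = (\<Prod>i\<in>-{k}. - a i * (?w i / a i))"
      by (simp only: prod.distrib)
    also have "\<dots> = (\<Prod>i\<in>-{k}. (-1) * ?w i)" using a by (intro prod.cong) auto
    also have "\<dots> = (-1) ^ CARD('d) * (\<Prod>i\<in>-{k}. ?w i)" by (simp only: prod.distrib prod_constant c)
    finally show ?thesis .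
  qed
  have facets: "(\<Sum>k\<in>UNIV. (?w k / of_nat W)\<^sup>2 * (\<Prod>i\<in>-{k}. - a i) * phi a (CARD('d), \<Sum>i\<in>-{k}. v i))
      = (-1) ^ CARD('d) * ?P / of_nat W"
  proof -
    have "(?w k / of_nat W)\<^sup>2 * (\<Prod>i\<in>-{k}. - a i) * phi a (CARD('d), \<Sum>i\<in>-{k}. v i)
        = ?w k * ((-1) ^ CARD('d) * ?P / of_nat W ^ 2)" for k
    proof -
      \<comment> \<open>One factor of the square of \<open>w k\<close> completes the product over
        all vertices; the other is left and sums to \<open>W\<close>.\<close>
      have P: "?P = ?w k * (\<Prod>i\<in>-{k}. ?w i)" by (simp add: Compl_eq_Diff_UNIV prod.remove)
      show ?thesis unfolding mult.assoc facet P by (simp add: power2_eq_square)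
    qed
    then have "(\<Sum>k\<in>UNIV. (?w k / of_nat W)\<^sup>2 * (\<Prod>i\<in>-{k}. - a i) * phi a (CARD('d), \<Sum>i\<in>-{k}. v i))
      = (\<Sum>k\<in>UNIV. ?w k) * ((-1) ^ CARD('d) * ?P / of_nat W ^ 2)"
      by (simp only: sum_distrib_right)
    also have "(\<Sum>k\<in>UNIV. ?w k) = of_nat W" by (simp add: W_def)
    finally show ?thesis using W_pos by (simp add: power2_eq_square)
  qed
  have full: "(\<Prod>i\<in>UNIV. - a i) * phi a (CARD('d), \<Sum>i\<in>UNIV. v i)
      = - ((-1) ^ CARD('d)) * of_nat W ^ (W - 1) * ?P * ((\<Prod>i\<in>UNIV. a i ^ w i) / (\<Prod>i\<in>UNIV. ?w i ^ w i))"
  proof -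
    have "phi a (CARD('d), \<Sum>i\<in>UNIV. v i) = of_nat W ^ (W - 1) * (\<Prod>i\<in>UNIV. (?w i / a i) powi (1 - int (w i)))"
      using phi_eq[OF vertex_sum_rep, of a] W_pos by simp
    then have "(\<Prod>i\<in>UNIV. - a i) * phi a (CARD('d), \<Sum>i\<in>UNIV. v i)
        = of_nat W ^ (W - 1) * (\<Prod>i\<in>UNIV. - a i * (?w i / a i) powi (1 - int (w i)))"
      by (simp only: prod.distrib mult.left_commute)
    also have "(\<Prod>i\<in>UNIV. - a i * (?w i / a i) powi (1 - int (w i))) = (\<Prod>i\<in>UNIV. (-1) * (?w i * (a i ^ w i / ?w i ^ w i)))"
    proof (rule prod.cong[OF refl])
      fix i
      have "?w i / a i \<noteq> 0" using a wnz by simp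
      then have "(?w i / a i) powi (1 - int (w i)) = ?w i / a i / (?w i / a i) ^ w i"
        by (simp add: power_int_diff)
      then show "- a i * (?w i / a i) powi (1 - int (w i)) = (-1) * (?w i * (a i ^ w i / ?w i ^ w i))"
        using a[of i] wnz[of i] by (simp add: power_divide field_simps)
    qed
    \<comment> \<open>There are \<open>d + 1\<close> signs here, one more than in a facet term,
      hence the minus sign in front of the power product.\<close>
    also have "\<dots> = (-1) ^ CARD('n) * (?P * ((\<Prod>i\<in>UNIV. a i ^ w i) / (\<Prod>i\<in>UNIV. ?w i ^ w i)))"
      by (simp only: prod.distrib prod_constant prod_dividef)
    finally show ?thesis by (simp add: card mult_ac)
  qed
  have "Phi a (Hf v a) = of_nat W ^ 2 * ((\<Prod>i\<in>UNIV. - a i) * phi a (CARD('d), \<Sum>i\<in>UNIV. v i) +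
      (\<Sum>k\<in>UNIV. (?w k / of_nat W)\<^sup>2 * (\<Prod>i\<in>-{k}. - a i) * phi a (CARD('d), \<Sum>i\<in>-{k}. v i)))"
    by (simp only: Hf_eq[OF \<sigma>] Phi_cst Phi_add Phi_sum Phi_single)
  also have "\<dots> = (-1) ^ CARD('d) * ?P * (of_nat W - of_nat W ^ 2 * of_nat W ^ (W - 1) * ((\<Prod>i\<in>UNIV. a i ^ w i) / (\<Prod>i\<in>UNIV. ?w i ^ w i)))"
    unfolding facets full using W_pos by (simp add: field_simps power2_eq_square)
  also have "complex_of_nat W ^ 2 * of_nat W ^ (W - 1) = of_nat W * of_nat (W ^ W)"
  proof -
    obtain N where "W = Suc N" using W_pos by (cases W) auto
    then show ?thesis by (simp add: power2_eq_square algebra_simps)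
  qed
  also have "(\<Prod>i\<in>UNIV. ?w i ^ w i) = of_nat (\<Prod>i\<in>UNIV. w i ^ w i)" by simp
  finally show ?thesis by (simp add: right_diff_distrib mult_ac)
qed

lemma subst_t_rep:
  assumes "(\<Sum>i\<in>UNIV. Poly_Mapping.lookup \<alpha> i) = CARD('d)"
  shows "is_rep (\<lambda>i. int (Poly_Mapping.lookup \<alpha> i)) CARD('d) (\<Sum>i\<in>UNIV. int (Poly_Mapping.lookup \<alpha> i) *s v i) 0"
  using assms by (simp add: is_rep_def flip: of_nat_sum)

lemma in_Sk_subst_t:
  assumes "homogeneous P CARD('d)"
  shows "in_Sk v CARD('d) (subst_t v a P)"
  unfolding subst_t_def
proof (rule in_Sk_sum)
  fix \<alpha> assume "\<alpha> \<in> Poly_Mapping.keys P"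
  then have "is_rep (\<lambda>i. int (Poly_Mapping.lookup \<alpha> i)) CARD('d) (\<Sum>i\<in>UNIV. int (Poly_Mapping.lookup \<alpha> i) *s v i) 0"
    using assms by (intro subst_t_rep) (simp add: homogeneous_def)
  from bary_of_rep[OF this]
  have "(CARD('d), \<Sum>i\<in>UNIV. int (Poly_Mapping.lookup \<alpha> i) *s v i) \<in> lattice_cone"
    by (auto simp: lattice_cone_def intro!: exI[of _ "\<lambda>i. real (Poly_Mapping.lookup \<alpha> i)"])
  then show "in_Sk v CARD('d) (Poly_Mapping.single (CARD('d), \<Sum>i\<in>UNIV. int (Poly_Mapping.lookup \<alpha> i) *s v i)
      (of_rat (Poly_Mapping.lookup P \<alpha>) * (\<Prod>i\<in>UNIV. a i ^ Poly_Mapping.lookup \<alpha> i)))"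
    unfolding in_Sk_iff by simp
qed

text \<open>Monomials of \<open>P\<close> give exponents of class zero, where \<open>phi\<close>
  carries the inverse powers of the \<open>a i\<close>. They cancel the powers coming from the
  substitution and leave \<open>P\<close> evaluated at \<open>w\<close>.\<close>

lemma Phi_subst_t:
  assumes hom: "homogeneous P CARD('d)" and a: "\<And>i. a i \<noteq> 0"
  shows "Phi a (subst_t v a P) = eval_mpoly P (\<lambda>i. of_nat (w i))"
  unfolding subst_t_def eval_mpoly_def Phi_sum Phi_single
proof (rule sum.cong[OF refl])
  fix \<alpha> assume "\<alpha> \<in> Poly_Mapping.keys P"
  then have "is_rep (\<lambda>i. int (Poly_Mapping.lookup \<alpha> i)) CARD('d) (\<Sum>i\<in>UNIV. int (Poly_Mapping.lookup \<alpha> i) *s v i) 0"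
    using hom by (intro subst_t_rep) (simp add: homogeneous_def)
  from phi_eq[OF this W_pos, of a]
  have "phi a (CARD('d), \<Sum>i\<in>UNIV. int (Poly_Mapping.lookup \<alpha> i) *s v i) = (\<Prod>i\<in>UNIV. (of_nat (w i) / a i) ^ Poly_Mapping.lookup \<alpha> i)"
    by simp
  then show "of_rat (Poly_Mapping.lookup P \<alpha>) * (\<Prod>i\<in>UNIV. a i ^ Poly_Mapping.lookup \<alpha> i) *
      phi a (CARD('d), \<Sum>i\<in>UNIV. int (Poly_Mapping.lookup \<alpha> i) *s v i) =
      of_rat (Poly_Mapping.lookup P \<alpha>) * (\<Prod>i\<in>UNIV. of_nat (w i) ^ Poly_Mapping.lookup \<alpha> i)"
    using a by (simp add: mult.assoc power_divide flip: prod.distrib)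
qed

end

theorem mainTheorem8:
  fixes w :: "'n::finite \<Rightarrow> nat"
    and v :: "'n \<Rightarrow> int^'d::finite"
    and a :: "'n \<Rightarrow> complex"
    and P :: "('n \<Rightarrow>\<^sub>0 nat) \<Rightarrow>\<^sub>0 rat"
  assumes card: "CARD('n) = CARD('d) + 1"
    and wpos: "\<forall>i. 0 < w i"
    and wgcd: "Gcd (range w) = 1"
    and wdvd: "\<forall>i. w i dvd (\<Sum>j\<in>UNIV. w j)"
    and vgen: "\<forall>m :: int^'d. \<exists>c :: 'n \<Rightarrow> int. m = (\<Sum>i\<in>UNIV. c i *s v i)"
    and vrel: "(\<Sum>i\<in>UNIV. int (w i) *s v i) = 0"
    and hom: "homogeneous P CARD('d)"
    and reg: "Delta_regular v a"
    and den: "1 - of_nat ((\<Sum>j\<in>UNIV. w j) ^ (\<Sum>j\<in>UNIV. w j)) / of_nat (\<Prod>i\<in>UNIV. w i ^ w i)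
                * (\<Prod>i\<in>UNIV. a i ^ w i) \<noteq> (0::complex)"
  shows "(-1) ^ CARD('d) * toric_res v a (subst_t v a P)
         = (1 / of_nat (\<Prod>i\<in>UNIV. w i)) * eval_mpoly P (\<lambda>i. of_nat (w i))
           / (1 - of_nat ((\<Sum>j\<in>UNIV. w j) ^ (\<Sum>j\<in>UNIV. w j)) / of_nat (\<Prod>i\<in>UNIV. w i ^ w i)
                * (\<Prod>i\<in>UNIV. a i ^ w i))"
proof -
  obtain C s where "split_simplex w v C s"
    using split_simplex_exists[OF card wpos wgcd wdvd vgen vrel] by blast
  then interpret split_simplex w v C s .
  have a: "a i \<noteq> 0" for i by (rule Delta_regular_nonzero[OF reg])
  obtain \<sigma> :: "'d option \<Rightarrow> 'n" where \<sigma>: "bij \<sigma>" using bij_option_exists[OF card] by blast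
  define D where "D = 1 - of_nat (W ^ W) / of_nat (\<Prod>i\<in>UNIV. w i ^ w i) * (\<Prod>i\<in>UNIV. a i ^ w i)"
  define p where "p = complex_of_nat (\<Prod>i\<in>UNIV. w i)"
  have D: "D \<noteq> 0" using den unfolding D_def W_def .
  have p: "p \<noteq> 0" using wpos by (simp add: p_def)
  have H: "Phi a (Hf v a) = (-1) ^ CARD('d) * of_nat W * p * D"
    using Phi_Hf[OF a] by (simp only: D_def p_def of_nat_prod)
  \<comment> \<open>The assumption \<open>den\<close> enters here: it allows \<open>Phi\<close> to
    be normalised at \<open>H'\<close>.\<close>
  have Hnz: "Phi a (Hf v a) \<noteq> 0" unfolding H using D p W_pos by simp
  have "toric_res v a (subst_t v a P)
      = of_nat W / ((-1) ^ CARD('d) * of_nat W * p * D) * eval_mpoly P (\<lambda>i. of_nat (w i))"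
    using toric_res_eq[OF a in_Sk_Hf Hnz in_Sk_subst_t[OF hom]]
    by (simp only: VolDelta_eq[OF \<sigma>] H Phi_subst_t[OF hom a]) simp
  \<comment> \<open>The normalised volume \<open>W\<close> cancels the factor \<open>W\<close> in
    the value at \<open>H'\<close>; the sign in front of the residue then cancels the one in the
    denominator.\<close>
  also have "\<dots> = eval_mpoly P (\<lambda>i. of_nat (w i)) / ((-1) ^ CARD('d) * p * D)"
    using W_pos by (simp add: mult_ac)
  finally have "(-1) ^ CARD('d) * toric_res v a (subst_t v a P) = 1 / p * eval_mpoly P (\<lambda>i. of_nat (w i)) / D"
    by (simp add: field_simps)
  then show ?thesis by (simp only: D_def W_def p_def)
qed

end
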